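(* Consider observations $y_j=S_\vartheta(x_j)+\sigma_j(\vartheta)\xi_j$, $1\le j\le n$, $x_j=j/n$, where $\xi_1,\dots,\xi_n$ are i.i.d. $\mathcal N(0,1)$, $\vartheta=(\vartheta_1,\dots,\vartheta_l)'\in\mathbb R^l$ is a parameter, $S_\vartheta\in C[0,1]$, and $\sigma_j(\vartheta)=g(x_j,S_\vartheta)$ with $g$ satisfying conditions $\mathbf H_1$ and $\mathbf H_2$ (stated in the context). Let $\vartheta$ have prior density $\Phi(\vartheta)=\prod_{i=1}^l\varphi_i(\vartheta_i)$, where each $\varphi_i$ is a continuously differentiable bounded probability density on $\mathbb R$ with $\mathcal I_i=\int_{\mathbb R}(\dot\varphi_i(z))^2/\varphi_i(z)\,dz<\infty$. Let $\lambda:\mathbb R^l\to\mathbb R$ be continuously differentiable with, for every $1\le i\le l$, $\lim_{|\vartheta_i|\to\infty}\lambda(\vartheta)\varphi_i(\vartheta_i)=0$ and $\int_{\mathbb R^l}|\lambda_i'(\vartheta)|\Phi(\vartheta)d\vartheta<\infty$, where $\lambda_i'=\partial\lambda/\partial\vartheta_i$. Assume that for every $1\le i\le l$ there is $S'_{\vartheta,i}\in C[0,1]$ with $$\lim_{h\to0}\max_{0\le x\le1}\big|(S_{\vartheta+h\mathbf e_i}(x)-S_\vartheta(x)-S'_{\vartheta,i}(x)h)/h\big|=0,$$ $\mathbf e_i$ being the $i$th unit vector. Then for every square integrable estimator $\hat\lambda_n$ of $\lambda(\vartheta)$ based on $(y_1,\dots,y_n)$ and every $1\le i\le l$, $$\tilde{\mathbf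 E}(\hat\lambda_n-\lambda(\vartheta))^2\ge\frac{\Lambda_i^2}{F_i+B_i+\mathcal I_i},$$ where $\Lambda_i=\int_{\mathbb R^l}\lambda_i'(\vartheta)\Phi(\vartheta)d\vartheta$, $F_i=\sum_{j=1}^n\int_{\mathbb R^l}(S'_{\vartheta,i}(x_j)/\sigma_j(\vartheta))^2\Phi(\vartheta)d\vartheta$, and $B_i=\frac12\sum_{j=1}^n\int_{\mathbb R^l}\frac{\tilde{\mathbf L}_i^2(x_j,\vartheta)}{\sigma_j^4(\vartheta)}\Phi(\vartheta)d\vartheta$ with $\tilde{\mathbf L}_i(x,\vartheta)=\mathbf L_{x,S_\vartheta}(S'_{\vartheta,i})$.
   Context: $\tilde{\mathbf E}G(Y,\vartheta)=\int_{\mathbb R^l}\mathbf E_\vartheta G(Y,\vartheta)\Phi(\vartheta)d\vartheta$, where $\mathbf E_\vartheta$ is expectation under the law of $Y=(y_1,\dots,y_n)$ for parameter $\vartheta$. Notation: $\|f\|^2=\int_0^1f^2$, $|f|_*=\sup_{0\le t\le1}|f(t)|$. $\mathbf H_1$ (for some integer $k\ge1$ and $r>0$, with $W_r^k$ the set of 1-periodic $k$ times differentiable $f:\mathbb R\to\mathbb R$ with $\sum_{j=0}^k\|f^{(j)}\|^2\le r$): $g:[0,1]\times L_1[0,1]\to\mathbb R_+$ is square integrable in $x$, $\varsigma(S)=\int_0^1g^2(x,S)dx$ satisfies $\lim_{n\to\infty}\sup_{S\in W_r^k}|n^{-1}\sum_{j=1}^ng^2(j/n,S)-\varsigma(S)|=0$,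 $\inf_{0\le x\le1}\inf_{S\in W_r^k}g^2(x,S)>0$ and $\sup_{S\in W_r^k}\varsigma(S)<\infty$. $\mathbf H_2$: for every $x\in[0,1]$, $g^2(x,\cdot):C[0,1]\to\mathbb R$ is Fréchet differentiable at every $f_0\in C[0,1]$: $g^2(x,f)=g^2(x,f_0)+\mathbf L_{x,f_0}(f-f_0)+\Upsilon(x,f_0,f)$ for $f$ near $f_0$, with $\mathbf L_{x,f_0}$ a bounded linear functional on $C[0,1]$ and $|\Upsilon(x,f_0,f)|/|f-f_0|_*\to0$ as $|f-f_0|_*\to0$. *)

theory Defs
  imports "HOL-Probability.Probability"
begin

definition supn01 :: "(real \<Rightarrow> real) \<Rightarrow> real" where
  "supn01 f = Sup ((\<lambda>t. \<bar>f t\<bar>) ` {0..1})"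

definition C01 :: "(real \<Rightarrow> real) \<Rightarrow> bool" where
  "C01 f \<longleftrightarrow> continuous_on {0..1} f"

definition L1_01 :: "(real \<Rightarrow> real) \<Rightarrow> bool" where
  "L1_01 f \<longleftrightarrow> set_integrable lborel {0..1} f"

definition W_class :: "nat \<Rightarrow> real \<Rightarrow> (real \<Rightarrow> real) set" where
  "W_class k r = {f. (\<forall>t. f (t + 1) = f t)
      \<and> (\<forall>j<k. \<forall>t. ((deriv ^^ j) f) differentiable (at t))
      \<and> (\<forall>j\<le>k. set_integrable lborel {0..1} (\<lambda>t. ((deriv ^^ j) f t)\<^sup>2))
      \<and> (\<Sum>j\<le>k. (LINT t:{0..1}|lborel. ((deriv ^^ j) f t)\<^sup>2)) \<le> r}"

definition cond_H1 :: "(real \<Rightarrow> (real \<Rightarrow> real) \<Rightarrow> real) \<Rightarrow> bool" where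
  "cond_H1 g \<longleftrightarrow> (\<exists>k r. k \<ge> 1 \<and> r > 0 \<and>
      (\<forall>S. L1_01 S \<longrightarrow> set_integrable lborel {0..1} (\<lambda>x. (g x S)\<^sup>2)) \<and>
      (\<forall>\<epsilon>>0. \<exists>N. \<forall>m\<ge>N. \<forall>S\<in>W_class k r.
          \<bar>(\<Sum>j=1..m. (g (real j / real m) S)\<^sup>2) / real m
             - (LINT x:{0..1}|lborel. (g x S)\<^sup>2)\<bar> < \<epsilon>) \<and>
      (\<exists>c>0. \<forall>x\<in>{0..1}. \<forall>S\<in>W_class k r. (g x S)\<^sup>2 \<ge> c) \<and>
      (\<exists>M. \<forall>S\<in>W_class k r. (LINT x:{0..1}|lborel. (g x S)\<^sup>2) \<le> M))"

text \<open>Condition H_2 on g, with the Frechet derivative L x f0 of g^2(x, .) at f0 given explicitly.\<close>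
definition cond_H2 :: "(real \<Rightarrow> (real \<Rightarrow> real) \<Rightarrow> real)
      \<Rightarrow> (real \<Rightarrow> (real \<Rightarrow> real) \<Rightarrow> (real \<Rightarrow> real) \<Rightarrow> real) \<Rightarrow> bool" where
  "cond_H2 g L \<longleftrightarrow> (\<forall>x\<in>{0..1}. \<forall>f0. C01 f0 \<longrightarrow>
      (\<forall>h1 h2. C01 h1 \<longrightarrow> C01 h2 \<longrightarrow> L x f0 (\<lambda>t. h1 t + h2 t) = L x f0 h1 + L x f0 h2) \<and>
      (\<forall>c h. C01 h \<longrightarrow> L x f0 (\<lambda>t. c * h t) = c * L x f0 h) \<and>
      (\<exists>C. \<forall>h. C01 h \<longrightarrow> \<bar>L x f0 h\<bar> \<le> C * supn01 h) \<and>
      (\<forall>\<epsilon>>0. \<exists>\<delta>>0. \<forall>f. C01 f \<longrightarrow> supn01 (\<lambda>t. f t - f0 t) < \<delta> \<longrightarrow>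
          \<bar>(g x f)\<^sup>2 - (g x f0)\<^sup>2 - L x f0 (\<lambda>t. f t - f0 t)\<bar> \<le> \<epsilon> * supn01 (\<lambda>t. f t - f0 t)))"

definition obs_law :: "nat \<Rightarrow> ('p \<Rightarrow> real \<Rightarrow> real) \<Rightarrow> (real \<Rightarrow> (real \<Rightarrow> real) \<Rightarrow> real)
      \<Rightarrow> 'p \<Rightarrow> (nat \<Rightarrow> real) measure" where
  "obs_law n S g \<theta> = PiM {1..n} (\<lambda>j. density lborel
      (normal_density (S \<theta> (real j / real n)) (g (real j / real n) (S \<theta>))))"

definition upd_coord :: "real ^ 'l \<Rightarrow> 'l \<Rightarrow> real \<Rightarrow> real ^ 'l" where
  "upd_coord \<theta> i t = (\<chi> j. if j = i then t else \<theta> $ j)"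

end

theory Submission
  imports Defs
begin

text \<open>Let \<open>w (y, \<theta>)\<close> be the joint density of observations and parameter and let \<open>q\<close> be its score in
  the direction of the \<open>i\<close>-th coordinate, so that \<open>\<partial>\<^sub>i w = q w\<close>. The function \<open>h = (est - lam) w\<close> has
  derivative \<open>\<partial>\<^sub>i h = (est - lam) q w - dlam\<^sub>i w\<close>. If the Bayes risk and the information are finite
  (otherwise the inequality is trivial), both \<open>h\<close> and \<open>\<partial>\<^sub>i h\<close> are integrable, hence \<open>\<partial>\<^sub>i h\<close> has integral
  zero, no boundary terms being involved. Thus the integral of \<open>dlam\<^sub>i w\<close> equals that of
  \<open>(est - lam) q w\<close>, and the Cauchy--Schwarz inequality bounds its square by the risk times the integral
  of \<open>q\<^sup>2 w\<close>. The score is the prior score plus independent centred Gaussian terms, whose second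
  moments add up to the stated information.

  No joint regularity in \<open>\<theta>\<close> is assumed, so measurability in \<open>\<theta>\<close> of the means and variances has to be
  obtained from their continuity in each coordinate separately.\<close>

subsection \<open>Integrals of directional derivatives\<close>

lemma integrable_lborel_translate:
  fixes f :: "'a::euclidean_space \<Rightarrow> real"
  assumes "integrable lborel f"
  shows "integrable lborel (\<lambda>x. f (x + c))" "(\<integral>x. f (x + c) \<partial>lborel) = (\<integral>x. f x \<partial>lborel)"
proof -
  have *: "lborel = distr lborel borel (\<lambda>x::'a. x + c)"
    using lborel_distr_plus[of c] by (simp add: add.commute[of c] cong: distr_cong)
  have f: "f \<in> borel_measurable borel" using assms by auto
  show "integrable lborel (\<lambda>x. f (x + c))"
    by (subst integrable_distr_eq[symmetric, of _ _ borel]) (use f assms *[symmetric] in auto)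
  show "(\<integral>x. f (x + c) \<partial>lborel) = (\<integral>x. f x \<partial>lborel)"
    by (subst integral_distr[symmetric, of _ _ borel]) (use f *[symmetric] in auto)
qed

lemma nn_integral_lborel_translate:
  fixes f :: "'a::euclidean_space \<Rightarrow> ennreal"
  assumes [measurable]: "f \<in> borel_measurable borel"
  shows "(\<integral>\<^sup>+x. f (x + c) \<partial>lborel) = (\<integral>\<^sup>+x. f x \<partial>lborel)"
proof -
  have *: "lborel = distr lborel borel (\<lambda>x::'a. x + c)"
    using lborel_distr_plus[of c] by (simp add: add.commute[of c] cong: distr_cong)
  show ?thesis
    by (subst (2) *, subst nn_integral_distr) auto
qed

text \<open>By translation invariance, integrating \<open>h (x + v) - h x = \<integral>\<^sub>0\<^sup>1 h' (x + s v) ds\<close> over all \<open>x\<close>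
  gives \<open>0 = \<integral> h'\<close>; integrability of \<open>h\<close> and \<open>h'\<close> replaces any decay condition at infinity.\<close>

lemma integral_directional_derivative_eq_0:
  fixes h h' :: "'a::euclidean_space \<Rightarrow> real"
  assumes h: "integrable lborel h" and h': "integrable lborel h'"
    and deriv: "\<And>x. ((\<lambda>t. h (x + t *\<^sub>R v)) has_real_derivative h' x) (at 0)"
  shows "(\<integral>x. h' x \<partial>lborel) = 0"
proof -
  have [measurable]: "h \<in> borel_measurable borel" "h' \<in> borel_measurable borel"
    using h h' by auto
  \<comment> \<open>Cutting \<open>s\<close> off to [0,1] makes the double integral of
    \<open>|K|\<close> equal to the L1 norm of \<open>h'\<close>, since every slice in
    \<open>x\<close> is a translate of \<open>h'\<close>; this licenses Fubini.\<close>
  define K where "K = (\<lambda>(s::real, x). indicator {0..1} s * h' (x + s *\<^sub>R v))"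
  have K_meas[measurable]: "K \<in> borel_measurable (lborel \<Otimes>\<^sub>M lborel)"
    unfolding K_def by measurable
  have "(\<integral>\<^sup>+z. ennreal (norm (K z)) \<partial>(lborel \<Otimes>\<^sub>M lborel))
      = (\<integral>\<^sup>+s. (\<integral>\<^sup>+x. ennreal (norm (K (s, x))) \<partial>lborel) \<partial>lborel)"
    by (rule lborel.nn_integral_fst[symmetric]) measurable
  also have "\<dots> = (\<integral>\<^sup>+s. indicator {0..1} s * (\<integral>\<^sup>+x. ennreal (norm (h' x)) \<partial>lborel) \<partial>(lborel :: real measure))"
  proof (rule nn_integral_cong)
    fix s :: real
    have "(\<integral>\<^sup>+x. ennreal (norm (h' (x + s *\<^sub>R v))) \<partial>lborel) = (\<integral>\<^sup>+x. ennreal (norm (h' x)) \<partial>lborel)"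
      by (rule nn_integral_lborel_translate) measurable
    then show "(\<integral>\<^sup>+x. ennreal (norm (K (s, x))) \<partial>lborel)
        = indicator {0..1} s * (\<integral>\<^sup>+x. ennreal (norm (h' x)) \<partial>lborel)"
      by (auto simp: K_def split: split_indicator)
  qed
  also have "\<dots> = (\<integral>\<^sup>+x. ennreal (norm (h' x)) \<partial>lborel)"
    by (simp add: nn_integral_multc)
  also have "\<dots> < \<infinity>"
    using h' by (simp add: integrable_iff_bounded)
  finally have K: "integrable (lborel \<Otimes>\<^sub>M lborel) K"
    by (intro integrableI_bounded K_meas)
  then have K': "integrable (lborel \<Otimes>\<^sub>M lborel) (\<lambda>(s, x). K (s, x))" by simp
  have "(\<integral>s. (\<integral>x. K (s, x) \<partial>lborel) \<partial>lborel) = (\<integral>s. indicator {0..1} s * (\<integral>x. h' x \<partial>lborel) \<partial>(lborel :: real measure))"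
    by (intro Bochner_Integration.integral_cong refl) (simp add: K_def integrable_lborel_translate(2)[OF h'])
  also have "\<dots> = (\<integral>x. h' x \<partial>lborel)" by simp
  finally have "(\<integral>x. h' x \<partial>lborel) = (\<integral>x. (\<integral>s. K (s, x) \<partial>lborel) \<partial>lborel)"
    using lborel_pair.Fubini_integral[OF K'] by simp
  also have "\<dots> = (\<integral>x. h (x + v) - h x \<partial>lborel)"
  proof (rule integral_cong_AE)
    show "(\<lambda>x. \<integral>s. K (s, x) \<partial>lborel) \<in> borel_measurable lborel"
      using lborel_pair.integrable_snd[OF K'] by auto
    show "(\<lambda>x. h (x + v) - h x) \<in> borel_measurable lborel" by measurable
    \<comment> \<open>The fundamental theorem yields a gauge integral and works for a merely
      existing derivative. It agrees with the Lebesgue integral on almost every line, namely where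
      the slice of \<open>K\<close> is integrable.\<close>
    show "AE x in lborel. (\<integral>s. K (s, x) \<partial>lborel) = h (x + v) - h x"
      using lborel_pair.AE_integrable_snd[OF K']
    proof eventually_elim
      case (elim x)
      then have si: "set_integrable lborel {0..1} (\<lambda>s. h' (x + s *\<^sub>R v))"
        by (simp add: set_integrable_def K_def)
      have "((\<lambda>s. h (x + s *\<^sub>R v)) has_vector_derivative h' (x + s *\<^sub>R v)) (at s within {0..1})" for s
      proof -
        \<comment> \<open>The hypothesis differentiates at parameter 0 only; taking
          \<open>x + s v\<close> as base point and shifting gives the derivative at every
          \<open>s\<close>.\<close>
        have "((\<lambda>t. h (x + s *\<^sub>R v + t *\<^sub>R v)) has_real_derivative h' (x + s *\<^sub>R v)) (at 0)"
          by (rule deriv)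
        then have "((\<lambda>t. h (x + (t + s) *\<^sub>R v)) has_real_derivative h' (x + s *\<^sub>R v)) (at 0)"
          by (simp add: algebra_simps)
        then have "((\<lambda>s. h (x + s *\<^sub>R v)) has_real_derivative h' (x + s *\<^sub>R v)) (at s)"
          using DERIV_shift[of "\<lambda>t. h (x + t *\<^sub>R v)" "h' (x + s *\<^sub>R v)" 0 s] by simp
        then show ?thesis
          using has_real_derivative_iff_has_vector_derivative has_vector_derivative_at_within by blast
      qed
      then have "((\<lambda>s. h' (x + s *\<^sub>R v)) has_integral (h (x + 1 *\<^sub>R v) - h (x + 0 *\<^sub>R v))) {0..1}"
        by (intro fundamental_theorem_of_calculus) auto
      then show ?case
        using set_borel_integral_eq_integral(2)[OF si]
        by (simp add: K_def set_lebesgue_integral_def integral_unique)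
    qed
  qed
  also have "\<dots> = 0"
    using h integrable_lborel_translate[OF h] by simp
  finally show ?thesis .
qed

subsection \<open>An abstract van Trees inequality\<close>

text \<open>Writing the derivative of \<open>w\<close> as \<open>q w\<close> introduces the score
  without dividing by \<open>w\<close>, which may vanish. Finite risk and information make
  \<open>(e - lam) w\<close> and its derivative integrable.\<close>

lemma van_trees_abstract:
  fixes w q :: "'m \<times> 'a::euclidean_space \<Rightarrow> real"
  assumes "sigma_finite_measure M"
    and [measurable]: "w \<in> borel_measurable (M \<Otimes>\<^sub>M lborel)" "q \<in> borel_measurable (M \<Otimes>\<^sub>M lborel)"
      "e \<in> borel_measurable M" "lam \<in> borel_measurable borel" "dlam \<in> borel_measurable borel"
    and w_nonneg: "\<And>z. w z \<ge> 0"
    and w_deriv: "\<And>y x. y \<in> space M \<Longrightarrow>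
      ((\<lambda>t. w (y, x + t *\<^sub>R v)) has_real_derivative q (y, x) * w (y, x)) (at 0)"
    and lam_deriv: "\<And>x. ((\<lambda>t. lam (x + t *\<^sub>R v)) has_real_derivative dlam x) (at 0)"
    and w: "integrable (M \<Otimes>\<^sub>M lborel) w"
    and dlam: "integrable (M \<Otimes>\<^sub>M lborel) (\<lambda>z. dlam (snd z) * w z)"
    and risk: "(\<integral>\<^sup>+z. ennreal ((e (fst z) - lam (snd z))\<^sup>2 * w z) \<partial>(M \<Otimes>\<^sub>M lborel)) < \<infinity>"
    and info: "(\<integral>\<^sup>+z. ennreal ((q z)\<^sup>2 * w z) \<partial>(M \<Otimes>\<^sub>M lborel)) < \<infinity>"
  shows "ennreal ((\<integral>z. dlam (snd z) * w z \<partial>(M \<Otimes>\<^sub>M lborel))\<^sup>2)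
    \<le> (\<integral>\<^sup>+z. ennreal ((e (fst z) - lam (snd z))\<^sup>2 * w z) \<partial>(M \<Otimes>\<^sub>M lborel))
      * (\<integral>\<^sup>+z. ennreal ((q z)\<^sup>2 * w z) \<partial>(M \<Otimes>\<^sub>M lborel))"
proof -
  interpret M: sigma_finite_measure M by fact
  interpret pair_sigma_finite M "lborel :: 'a measure" ..
  let ?P = "M \<Otimes>\<^sub>M (lborel :: 'a measure)"
  define d where "d z = e (fst z) - lam (snd z)" for z
  have [measurable]: "d \<in> borel_measurable ?P" unfolding d_def by measurable
  have dd: "integrable ?P (\<lambda>z. (d z)\<^sup>2 * w z)" "integrable ?P (\<lambda>z. (q z)\<^sup>2 * w z)"
    using risk info w_nonneg by (auto simp: integrable_iff_bounded d_def)
  define h where "h z = d z * w z" for z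
  define h' where "h' z = d z * q z * w z - dlam (snd z) * w z" for z
  \<comment> \<open>Dominated by \<open>d^2 w + w\<close>: a finite risk plus a finite mass.\<close>
  have h: "integrable ?P h"
  proof (rule Bochner_Integration.integrable_bound[OF Bochner_Integration.integrable_add[OF dd(1) w]])
    show "h \<in> borel_measurable ?P" unfolding h_def by measurable
    \<comment> \<open>Expanding \<open>(|a| - 1/2)^2 >= 0\<close> gives even
      \<open>|a| <= a^2 + 1/4\<close>.\<close>
    have "\<bar>a\<bar> \<le> a\<^sup>2 + 1" for a :: real
      using zero_le_power2[of "\<bar>a\<bar> - 1 / 2"] by (simp add: power2_eq_square algebra_simps)
    from mult_right_mono[OF this w_nonneg]
    show "AE z in ?P. norm (h z) \<le> norm ((d z)\<^sup>2 * w z + w z)"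
      using w_nonneg by (intro AE_I2) (simp add: h_def abs_mult distrib_right)
  qed
  have dqw: "integrable ?P (\<lambda>z. d z * q z * w z)"
  proof (rule Bochner_Integration.integrable_bound[OF Bochner_Integration.integrable_add[OF dd]])
    have "\<bar>a * b\<bar> \<le> a\<^sup>2 + b\<^sup>2" for a b :: real
      using sum_squares_bound[of "\<bar>a\<bar>" "\<bar>b\<bar>"] abs_ge_zero[of "a * b"]
      unfolding abs_mult power2_abs by linarith
    from mult_right_mono[OF this w_nonneg]
    show "AE z in ?P. norm (d z * q z * w z) \<le> norm ((d z)\<^sup>2 * w z + (q z)\<^sup>2 * w z)"
      using w_nonneg by (intro AE_I2) (simp add: abs_mult distrib_right)
  qed measurable
  have h': "integrable ?P h'"
    unfolding h'_def by (intro Bochner_Integration.integrable_diff dqw dlam)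
  have "(\<integral>z. h' z \<partial>?P) = (\<integral>y. (\<integral>x. h' (y, x) \<partial>lborel) \<partial>M)"
    by (rule integral_fst'[OF h', symmetric])
  also have "\<dots> = (\<integral>y. 0 \<partial>M)"
  proof (rule integral_cong_AE)
    show "(\<lambda>y. \<integral>x. h' (y, x) \<partial>lborel) \<in> borel_measurable M"
      using integrable_fst'[OF h'] by auto
    \<comment> \<open>Integrability on the product passes to almost every slice in \<open>y\<close>;
      on such a slice the derivative in \<open>x\<close> integrates to zero.\<close>
    show "AE y in M. (\<integral>x. h' (y, x) \<partial>lborel) = 0"
      using AE_integrable_fst'[OF h] AE_integrable_fst'[OF h'] AE_space
    proof eventually_elim
      case (elim y)
      show ?case
      proof (rule integral_directional_derivative_eq_0[OF elim(1,2), of v])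
        fix x
        have "((\<lambda>t. h (y, x + t *\<^sub>R v)) has_real_derivative
            (0 - dlam x) * w (y, x + 0 *\<^sub>R v) + q (y, x) * w (y, x) * d (y, x + 0 *\<^sub>R v)) (at 0)"
          unfolding h_def d_def fst_conv snd_conv
          by (intro DERIV_mult DERIV_diff DERIV_const lam_deriv w_deriv elim(3))
        then show "((\<lambda>t. h (y, x + t *\<^sub>R v)) has_real_derivative h' (y, x)) (at 0)"
          by (simp add: h'_def algebra_simps)
      qed
    qed
  qed simp
  finally have "(\<integral>z. dlam (snd z) * w z \<partial>?P) = (\<integral>z. d z * q z * w z \<partial>?P)"
    unfolding h'_def using dqw dlam by simp
  also have "ennreal (\<bar>\<dots>\<bar>) \<le> (\<integral>\<^sup>+z. ennreal (\<bar>d z * q z * w z\<bar>) \<partial>?P)"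
    using integral_norm_bound_ennreal[OF dqw] by simp
  \<comment> \<open>Each factor receives \<open>sqrt w\<close>, so that after Cauchy-Schwarz both
    squares carry the weight \<open>w\<close>.\<close>
  also have "\<dots> = (\<integral>\<^sup>+z. ennreal (\<bar>d z\<bar> * sqrt (w z)) * ennreal (\<bar>q z\<bar> * sqrt (w z)) \<partial>?P)"
  proof (rule nn_integral_cong)
    fix z
    have "\<bar>d z * q z * w z\<bar> = (\<bar>d z\<bar> * sqrt (w z)) * (\<bar>q z\<bar> * sqrt (w z))"
      using w_nonneg[of z] real_sqrt_mult_self[of "w z"] by (simp add: abs_mult algebra_simps)
    then show "ennreal (\<bar>d z * q z * w z\<bar>) = ennreal (\<bar>d z\<bar> * sqrt (w z)) * ennreal (\<bar>q z\<bar> * sqrt (w z))"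
      using w_nonneg[of z] by (simp add: ennreal_mult)
  qed
  finally have "(ennreal \<bar>\<integral>z. dlam (snd z) * w z \<partial>?P\<bar>)\<^sup>2
      \<le> (\<integral>\<^sup>+z. ennreal (\<bar>d z\<bar> * sqrt (w z)) * ennreal (\<bar>q z\<bar> * sqrt (w z)) \<partial>?P)\<^sup>2"
    by (intro power_mono) auto
  also have "\<dots> \<le> (\<integral>\<^sup>+z. (ennreal (\<bar>d z\<bar> * sqrt (w z)))\<^sup>2 \<partial>?P) * (\<integral>\<^sup>+z. (ennreal (\<bar>q z\<bar> * sqrt (w z)))\<^sup>2 \<partial>?P)"
    by (rule Cauchy_Schwarz_nn_integral) measurable
  also have "\<dots> = (\<integral>\<^sup>+z. ennreal ((d z)\<^sup>2 * w z) \<partial>?P) * (\<integral>\<^sup>+z. ennreal ((q z)\<^sup>2 * w z) \<partial>?P)"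
    using w_nonneg by (simp add: ennreal_power power_mult_distrib)
  finally show ?thesis
    by (simp add: d_def ennreal_power)
qed

subsection \<open>Product densities and the Gaussian score\<close>

text \<open>Turns a family of product laws into densities against one fixed product measure. Both
  sides assign to a rectangle the product of the one-dimensional integrals over its sides, and
  rectangles determine a product measure.\<close>

lemma PiM_density:
  fixes p :: "'i \<Rightarrow> 'a \<Rightarrow> real"
  assumes M: "\<And>i. sigma_finite_measure (M i)" and I: "finite I"
    and p[measurable]: "\<And>i. i \<in> I \<Longrightarrow> p i \<in> borel_measurable (M i)"
    and p_nonneg: "\<And>i x. i \<in> I \<Longrightarrow> 0 \<le> p i x"
    and prob: "\<And>i. i \<in> I \<Longrightarrow> prob_space (density (M i) (p i))"
  shows "PiM I (\<lambda>i. density (M i) (p i)) = density (PiM I M) (\<lambda>x. ennreal (\<Prod>i\<in>I. p i (x i)))"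
proof -
  interpret product_sigma_finite M by (intro product_sigma_finite.intro M)
  \<comment> \<open>A product of sigma-finite measures needs a sigma-finite factor at every index,
    but \<open>p i\<close> is controlled only on \<open>I\<close>; elsewhere \<open>N\<close> falls
    back to \<open>M\<close>.\<close>
  define N where "N i = (if i \<in> I then density (M i) (p i) else M i)" for i
  interpret N: product_sigma_finite N
    by (intro product_sigma_finite.intro) (simp add: N_def M prob prob_space_imp_sigma_finite)
  have N_eq: "PiM I (\<lambda>i. density (M i) (p i)) = PiM I N"
    by (rule PiM_cong) (auto simp: N_def)
  have "density (PiM I M) (\<lambda>x. ennreal (\<Prod>i\<in>I. p i (x i))) = PiM I N"
  proof (rule N.PiM_eqI[OF I])
    show "sets (density (PiM I M) (\<lambda>x. ennreal (\<Prod>i\<in>I. p i (x i)))) = sets (PiM I N)"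
      unfolding sets_density by (intro sets_PiM_cong) (auto simp: N_def)
  next
    fix A assume "\<And>i. i \<in> I \<Longrightarrow> A i \<in> sets (N i)"
    then have A: "A i \<in> sets (M i)" if "i \<in> I" for i
      using that by (auto simp: N_def)
    have "emeasure (density (PiM I M) (\<lambda>x. ennreal (\<Prod>i\<in>I. p i (x i)))) (PiE I A)
        = (\<integral>\<^sup>+x. ennreal (\<Prod>i\<in>I. p i (x i)) * indicator (PiE I A) x \<partial>PiM I M)"
      by (intro emeasure_density sets_PiM_I_finite I A) measurable
    also have "\<dots> = (\<integral>\<^sup>+x. (\<Prod>i\<in>I. ennreal (p i (x i)) * indicator (A i) (x i)) \<partial>PiM I M)"
    proof (rule nn_integral_cong)
      fix x assume x: "x \<in> space (PiM I M)"
      have "(indicator (PiE I A) x :: ennreal) = (\<Prod>i\<in>I. indicator (A i) (x i))"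
      proof (cases "\<forall>i\<in>I. x i \<in> A i")
        case True
        then show ?thesis using x by (simp add: space_PiM PiE_iff)
      next
        case False
        then show ?thesis using I by (auto simp: PiE_iff prod_zero_iff indicator_def)
      qed
      moreover have "ennreal (\<Prod>i\<in>I. p i (x i)) = (\<Prod>i\<in>I. ennreal (p i (x i)))"
        using p_nonneg by (intro prod_ennreal[symmetric])
      ultimately show "ennreal (\<Prod>i\<in>I. p i (x i)) * indicator (PiE I A) x
          = (\<Prod>i\<in>I. ennreal (p i (x i)) * indicator (A i) (x i))"
        by (simp only: prod.distrib)
    qed
    also have "\<dots> = (\<Prod>i\<in>I. \<integral>\<^sup>+x. ennreal (p i x) * indicator (A i) x \<partial>M i)"
      using I A by (intro product_nn_integral_prod) auto
    also have "\<dots> = (\<Prod>i\<in>I. emeasure (N i) (A i))"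
      using A by (intro prod.cong refl) (simp add: N_def emeasure_density)
    finally show "emeasure (density (PiM I M) (\<lambda>x. ennreal (\<Prod>i\<in>I. p i (x i)))) (PiE I A)
        = (\<Prod>i\<in>I. emeasure (N i) (A i))" .
  qed
  then show ?thesis by (simp add: N_eq)
qed

text \<open>Prescribing the second moment of \<open>c + u i\<close> for every shift \<open>c\<close>
  encodes mean zero and variance \<open>s i\<close> within nonnegative integrals, so no cross terms
  have to be integrated. In the induction the shift absorbs the inserted coordinate, held fixed
  while the others are integrated.\<close>

lemma nn_integral_PiM_square_sum:
  fixes u :: "'i \<Rightarrow> 'a \<Rightarrow> real" and s :: "'i \<Rightarrow> real"
  assumes M: "\<And>i. sigma_finite_measure (M i)" and "finite I"
    and [measurable]: "\<And>i. i \<in> I \<Longrightarrow> u i \<in> borel_measurable (M i)"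
    and s: "\<And>i. i \<in> I \<Longrightarrow> 0 \<le> s i"
    and u: "\<And>i c. i \<in> I \<Longrightarrow> (\<integral>\<^sup>+x. ennreal ((c + u i x)\<^sup>2) \<partial>M i) = ennreal (c\<^sup>2 + s i)"
    and prob: "\<And>i. i \<in> I \<Longrightarrow> emeasure (M i) (space (M i)) = 1"
  shows "(\<integral>\<^sup>+x. ennreal ((c + (\<Sum>i\<in>I. u i (x i)))\<^sup>2) \<partial>PiM I M) = ennreal (c\<^sup>2 + (\<Sum>i\<in>I. s i))"
  using assms(2-)
proof (induction I arbitrary: c rule: finite_induct)
  case empty
  interpret product_sigma_finite M by (intro product_sigma_finite.intro M)
  show ?case by (simp add: nn_integral_empty space_PiM emeasure_PiM_empty)
next
  case (insert i I)
  interpret product_sigma_finite M by (intro product_sigma_finite.intro M)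
  note insert.prems(1)[measurable]
  have "(\<integral>\<^sup>+x. ennreal ((c + (\<Sum>j\<in>insert i I. u j (x j)))\<^sup>2) \<partial>PiM (insert i I) M)
     = (\<integral>\<^sup>+y. (\<integral>\<^sup>+x. ennreal ((c + (\<Sum>j\<in>insert i I. u j ((x(i := y)) j)))\<^sup>2) \<partial>PiM I M) \<partial>M i)"
    using insert.hyps by (intro product_nn_integral_insert_rev) auto
  also have "\<dots> = (\<integral>\<^sup>+y. (\<integral>\<^sup>+x. ennreal (((c + u i y) + (\<Sum>j\<in>I. u j (x j)))\<^sup>2) \<partial>PiM I M) \<partial>M i)"
  proof (intro nn_integral_cong)
    fix x y
    have "(\<Sum>j\<in>I. u j ((x(i := y)) j)) = (\<Sum>j\<in>I. u j (x j))"
      using insert.hyps by (intro sum.cong) auto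
    then show "ennreal ((c + (\<Sum>j\<in>insert i I. u j ((x(i := y)) j)))\<^sup>2)
        = ennreal (((c + u i y) + (\<Sum>j\<in>I. u j (x j)))\<^sup>2)"
      using insert.hyps by (simp add: add.assoc)
  qed
  also have "\<dots> = (\<integral>\<^sup>+y. ennreal ((c + u i y)\<^sup>2 + (\<Sum>j\<in>I. s j)) \<partial>M i)"
    using insert by (intro nn_integral_cong insert.IH) auto
  also have "\<dots> = (\<integral>\<^sup>+y. ennreal ((c + u i y)\<^sup>2) + ennreal (\<Sum>j\<in>I. s j) \<partial>M i)"
    using insert.prems by (intro nn_integral_cong ennreal_plus) (auto intro: sum_nonneg)
  also have "\<dots> = (\<integral>\<^sup>+y. ennreal ((c + u i y)\<^sup>2) \<partial>M i) + ennreal (\<Sum>j\<in>I. s j)"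
    using insert.prems by (subst nn_integral_add) auto
  also have "\<dots> = ennreal (c\<^sup>2 + (\<Sum>j\<in>insert i I. s j))"
    using insert.prems insert.hyps
    by (simp add: ennreal_plus[symmetric] sum_nonneg add.assoc del: ennreal_plus)
  finally show ?case .
qed

text \<open>Parametrised by the variance, since \<open>normal_density\<close> depends on the standard deviation
  only through its square.\<close>

lemma normal_score_second_moment:
  fixes v m :: real
  assumes v: "v > 0"
  shows "(\<integral>\<^sup>+x. ennreal ((c + (a / v * (x - m) + b / (2 * v\<^sup>2) * ((x - m)\<^sup>2 - v)))\<^sup>2)
      \<partial>density lborel (normal_density m (sqrt v))) = ennreal (c\<^sup>2 + (a\<^sup>2 / v + b\<^sup>2 / v\<^sup>2 / 2))"
proof -
  define N where "N = normal_density m (sqrt v)"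
  define \<alpha> where "\<alpha> = a / v"
  define \<beta> where "\<beta> = b / (2 * v\<^sup>2)"
  \<comment> \<open>The constant term when \<open>c\<close> plus the score is expanded in powers of
    \<open>x - m\<close>. The square is then a quartic, to be integrated with the central moments up
    to order four.\<close>
  define k where "k = c - \<beta> * v"
  have s: "sqrt v > 0" using v by simp
  have m0: "has_bochner_integral lborel N 1"
    using normal_moment_even[OF s, of m 0] by (simp add: N_def)
  have m1: "has_bochner_integral lborel (\<lambda>x. N x * (x - m)) 0"
    using normal_moment_odd[OF s, of m 0] by (simp add: N_def)
  have m2: "has_bochner_integral lborel (\<lambda>x. N x * (x - m) ^ 2) v"
    using normal_moment_even[OF s, of m 1] v by (simp add: N_def)
  have m3: "has_bochner_integral lborel (\<lambda>x. N x * (x - m) ^ 3) 0"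
    using normal_moment_odd[OF s, of m 1] by (simp add: N_def numeral_3_eq_3)
  \<comment> \<open>The general even-moment formula at order four, which reduces to the Gaussian
    value \<open>3 v^2\<close>.\<close>
  have "fact 4 / ((2 / v)\<^sup>2 * fact 2) = 3 * v\<^sup>2"
    using v by (simp add: fact_numeral power_divide)
  then have m4: "has_bochner_integral lborel (\<lambda>x. N x * (x - m) ^ 4) (3 * v\<^sup>2)"
    using normal_moment_even[OF s, of m 2] v by (simp add: N_def)
  have "has_bochner_integral lborel (\<lambda>x. k\<^sup>2 * N x + 2 * k * \<alpha> * (N x * (x - m))
      + (\<alpha>\<^sup>2 + 2 * k * \<beta>) * (N x * (x - m) ^ 2) + 2 * \<alpha> * \<beta> * (N x * (x - m) ^ 3)
      + \<beta>\<^sup>2 * (N x * (x - m) ^ 4))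
    (k\<^sup>2 * 1 + 2 * k * \<alpha> * 0 + (\<alpha>\<^sup>2 + 2 * k * \<beta>) * v + 2 * \<alpha> * \<beta> * 0 + \<beta>\<^sup>2 * (3 * v\<^sup>2))"
    by (intro has_bochner_integral_add has_bochner_integral_mult_right m0 m1 m2 m3 m4)
  moreover have "k\<^sup>2 * N x + 2 * k * \<alpha> * (N x * (x - m))
      + (\<alpha>\<^sup>2 + 2 * k * \<beta>) * (N x * (x - m) ^ 2) + 2 * \<alpha> * \<beta> * (N x * (x - m) ^ 3)
      + \<beta>\<^sup>2 * (N x * (x - m) ^ 4) = N x * (c + (\<alpha> * (x - m) + \<beta> * ((x - m)\<^sup>2 - v)))\<^sup>2" for x
    unfolding k_def by algebra
  \<comment> \<open>The terms linear in \<open>c\<close> cancel and leave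
    \<open>c^2 + \<alpha>^2 v + 2 \<beta>^2 v^2\<close>. As \<open>\<beta> = b / (2 v^2)\<close>,
    the last term is the source of the factor 1/2 in \<open>B_i\<close>.\<close>
  moreover have "k\<^sup>2 * 1 + 2 * k * \<alpha> * 0 + (\<alpha>\<^sup>2 + 2 * k * \<beta>) * v + 2 * \<alpha> * \<beta> * 0 + \<beta>\<^sup>2 * (3 * v\<^sup>2)
      = c\<^sup>2 + (a\<^sup>2 / v + b\<^sup>2 / v\<^sup>2 / 2)"
  proof -
    have "a = \<alpha> * v" "b = 2 * \<beta> * v\<^sup>2" using v by (auto simp: \<alpha>_def \<beta>_def)
    then have "a\<^sup>2 / v = \<alpha>\<^sup>2 * v" "b\<^sup>2 / v\<^sup>2 / 2 = 2 * \<beta>\<^sup>2 * v\<^sup>2"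
      using v by (auto simp: power2_eq_square)
    then show ?thesis unfolding k_def by algebra
  qed
  ultimately have I: "has_bochner_integral lborel
      (\<lambda>x. N x * (c + (\<alpha> * (x - m) + \<beta> * ((x - m)\<^sup>2 - v)))\<^sup>2) (c\<^sup>2 + (a\<^sup>2 / v + b\<^sup>2 / v\<^sup>2 / 2))"
    by simp
  have "(\<integral>\<^sup>+x. ennreal ((c + (\<alpha> * (x - m) + \<beta> * ((x - m)\<^sup>2 - v)))\<^sup>2) \<partial>density lborel N)
      = (\<integral>\<^sup>+x. ennreal (N x * (c + (\<alpha> * (x - m) + \<beta> * ((x - m)\<^sup>2 - v)))\<^sup>2) \<partial>lborel)"
    by (subst nn_integral_density) (auto simp: ennreal_mult N_def)
  also have "\<dots> = ennreal (c\<^sup>2 + (a\<^sup>2 / v + b\<^sup>2 / v\<^sup>2 / 2))"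
    using I by (subst nn_integral_eq_integral) (auto simp: has_bochner_integral_iff N_def)
  finally show ?thesis by (simp add: N_def \<alpha>_def \<beta>_def)
qed

text \<open>With the normalising factor moved into the exponent, differentiating in the parameters
  produces the score directly.\<close>

lemma normal_density_sqrt_eq_exp:
  assumes "v > 0"
  shows "normal_density m (sqrt v) y = exp (- (ln (2 * pi * v) / 2) - (y - m)\<^sup>2 / (2 * v))"
proof -
  have "sqrt (2 * pi * v) = exp (ln (2 * pi * v) / 2)"
    using assms by (simp add: ln_sqrt[symmetric])
  then show ?thesis
    using assms by (simp add: normal_density_def exp_diff exp_minus inverse_eq_divide)
qed

text \<open>The factor in front of the density is the derivative of its exponent, that is, the
  Gaussian score in mean and variance. Positivity is assumed at all \<open>s\<close> because the
  exponential form replaces the whole function of \<open>s\<close>.\<close>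

lemma normal_density_DERIV:
  assumes m: "(m has_real_derivative m') (at t)" and v: "(v has_real_derivative v') (at t)"
    and pos: "\<And>s. v s > 0"
  shows "((\<lambda>s. normal_density (m s) (sqrt (v s)) y) has_real_derivative
      (m' / v t * (y - m t) + v' / (2 * (v t)\<^sup>2) * ((y - m t)\<^sup>2 - v t)) * normal_density (m t) (sqrt (v t)) y) (at t)"
proof -
  have nz: "v t \<noteq> 0" using pos[of t] by simp
  have "((\<lambda>s. ln (2 * pi * v s)) has_real_derivative v' / v t) (at t)"
    by (rule derivative_eq_intros v refl | use pos[of t] in simp)+
  then have l: "((\<lambda>s. ln (2 * pi * v s) / 2) has_real_derivative v' / v t / 2) (at t)"
    by (rule DERIV_cdivide)
  have "((\<lambda>s. y - m s) has_real_derivative - m') (at t)"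
    using DERIV_diff[OF DERIV_const m, of y] by simp
  from DERIV_power[OF this, of 2]
  have "((\<lambda>s. (y - m s)\<^sup>2) has_real_derivative - (2 * m' * (y - m t))) (at t)"
    by (simp add: algebra_simps)
  from DERIV_divide[OF this DERIV_cmult[OF v, of 2]] nz
  have r: "((\<lambda>s. (y - m s)\<^sup>2 / (2 * v s)) has_real_derivative
      (- (2 * m' * (y - m t)) * (2 * v t) - (y - m t)\<^sup>2 * (2 * v')) / (2 * v t * (2 * v t))) (at t)"
    by simp
  have eq: "- (v' / v t / 2) - (- (2 * m' * (y - m t)) * (2 * v t) - (y - m t)\<^sup>2 * (2 * v')) / (2 * v t * (2 * v t))
    = m' / v t * (y - m t) + v' / (2 * (v t)\<^sup>2) * ((y - m t)\<^sup>2 - v t)"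
    using nz by (simp add: power2_eq_square divide_simps) (simp add: algebra_simps)
  show ?thesis
    unfolding normal_density_sqrt_eq_exp[OF pos] eq[symmetric]
    using DERIV_fun_exp[OF DERIV_diff[OF DERIV_minus[OF l] r]] by (simp add: mult.commute)
qed

text \<open>Scores add under products, also where a factor vanishes, since no logarithm is taken.
  This serves both the likelihood and the prior.\<close>

lemma DERIV_prod_logarithmic:
  fixes f :: "'i \<Rightarrow> real \<Rightarrow> real"
  assumes "finite I" "\<And>i. i \<in> I \<Longrightarrow> (f i has_real_derivative u i * f i t) (at t)"
  shows "((\<lambda>t. \<Prod>i\<in>I. f i t) has_real_derivative (\<Sum>i\<in>I. u i) * (\<Prod>i\<in>I. f i t)) (at t)"
  using assms
proof (induction I rule: finite_induct)
  case (insert i I)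
  have "((\<lambda>t. f i t * (\<Prod>i\<in>I. f i t)) has_real_derivative
      u i * f i t * (\<Prod>i\<in>I. f i t) + (\<Sum>i\<in>I. u i) * (\<Prod>i\<in>I. f i t) * f i t) (at t)"
    by (intro DERIV_mult insert) (use insert in auto)
  then show ?case using insert.hyps by (simp add: algebra_simps)
qed simp

text \<open>Separates the statistical core from the regression model: means and variances are any
  measurable functions of the parameter that are differentiable along \<open>v\<close>, and
  \<open>\<psi>\<close> is the prior score.\<close>

lemma van_trees_gaussian:
  fixes m V a b :: "'i \<Rightarrow> 'a::euclidean_space \<Rightarrow> real" and \<Phi> \<psi> lam dlam :: "'a \<Rightarrow> real"
    and est :: "('i \<Rightarrow> real) \<Rightarrow> real" and v :: 'a and I :: "'i set"
  defines "obs \<theta> \<equiv> PiM I (\<lambda>j. density lborel (normal_density (m j \<theta>) (sqrt (V j \<theta>))))"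
  assumes I: "finite I"
    and meas[measurable]: "\<And>j. j \<in> I \<Longrightarrow> m j \<in> borel_measurable borel" "\<And>j. j \<in> I \<Longrightarrow> V j \<in> borel_measurable borel"
      "\<And>j. j \<in> I \<Longrightarrow> a j \<in> borel_measurable borel" "\<And>j. j \<in> I \<Longrightarrow> b j \<in> borel_measurable borel"
      "\<Phi> \<in> borel_measurable borel" "\<psi> \<in> borel_measurable borel"
      "lam \<in> borel_measurable borel" "dlam \<in> borel_measurable borel"
      "est \<in> borel_measurable (PiM I (\<lambda>_. lborel))"
    and V_pos: "\<And>j \<theta>. j \<in> I \<Longrightarrow> V j \<theta> > 0"
    and m_deriv: "\<And>j \<theta>. j \<in> I \<Longrightarrow> ((\<lambda>t. m j (\<theta> + t *\<^sub>R v)) has_real_derivative a j \<theta>) (at 0)"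
    and V_deriv: "\<And>j \<theta>. j \<in> I \<Longrightarrow> ((\<lambda>t. V j (\<theta> + t *\<^sub>R v)) has_real_derivative b j \<theta>) (at 0)"
    and \<Phi>_nonneg: "\<And>\<theta>. \<Phi> \<theta> \<ge> 0"
    and \<Phi>_deriv: "\<And>\<theta>. ((\<lambda>t. \<Phi> (\<theta> + t *\<^sub>R v)) has_real_derivative \<psi> \<theta> * \<Phi> \<theta>) (at 0)"
    and \<Phi>_int: "integrable lborel \<Phi>"
    and lam_deriv: "\<And>\<theta>. ((\<lambda>t. lam (\<theta> + t *\<^sub>R v)) has_real_derivative dlam \<theta>) (at 0)"
    and dlam_int: "integrable lborel (\<lambda>\<theta>. dlam \<theta> * \<Phi> \<theta>)"
  shows "ennreal ((\<integral>\<theta>. dlam \<theta> * \<Phi> \<theta> \<partial>lborel)\<^sup>2)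
      / (\<integral>\<^sup>+\<theta>. ennreal (\<Phi> \<theta> * ((\<psi> \<theta>)\<^sup>2 + (\<Sum>j\<in>I. (a j \<theta>)\<^sup>2 / V j \<theta> + (b j \<theta>)\<^sup>2 / (V j \<theta>)\<^sup>2 / 2))) \<partial>lborel)
    \<le> (\<integral>\<^sup>+\<theta>. ennreal (\<Phi> \<theta>) * (\<integral>\<^sup>+y. ennreal ((est y - lam \<theta>)\<^sup>2) \<partial>obs \<theta>) \<partial>lborel)"
    (is "?\<Lambda> / ?D \<le> ?R")
proof -
  \<comment> \<open>Lebesgue measure on the observation space dominates every law
    \<open>obs \<theta>\<close>, so that \<open>w\<close> below is a joint density.\<close>
  define Y where "Y = PiM I (\<lambda>_. lborel :: real measure)"
  interpret Y0: product_sigma_finite "\<lambda>_::'i. lborel :: real measure" ..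
  interpret Y: sigma_finite_measure Y unfolding Y_def by (rule Y0.sigma_finite[OF I])
  interpret P: pair_sigma_finite Y "lborel :: 'a measure" ..
  let ?P = "Y \<Otimes>\<^sub>M (lborel :: 'a measure)"
  have est[measurable]: "est \<in> borel_measurable Y" unfolding Y_def by measurable
  have comp[measurable]: "(\<lambda>y. y j) \<in> borel_measurable Y" if "j \<in> I" for j
    unfolding Y_def using that by measurable
  define p where "p z = (\<Prod>j\<in>I. normal_density (m j (snd z)) (sqrt (V j (snd z))) (fst z j))" for z :: "('i \<Rightarrow> real) \<times> 'a"
  define u where "u j \<theta> x = a j \<theta> / V j \<theta> * (x - m j \<theta>) + b j \<theta> / (2 * (V j \<theta>)\<^sup>2) * ((x - m j \<theta>)\<^sup>2 - V j \<theta>)" for j \<theta> x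
  define q where "q z = \<psi> (snd z) + (\<Sum>j\<in>I. u j (snd z) (fst z j))" for z :: "('i \<Rightarrow> real) \<times> 'a"
  define w where "w z = \<Phi> (snd z) * p z" for z
  have p_meas[measurable]: "p \<in> borel_measurable ?P"
    unfolding p_def normal_density_def by measurable
  have q_meas[measurable]: "q \<in> borel_measurable ?P"
    unfolding q_def u_def by measurable
  have w_meas[measurable]: "w \<in> borel_measurable ?P"
    unfolding w_def by measurable
  have p_nonneg: "p z \<ge> 0" for z
    unfolding p_def by (intro prod_nonneg) simp
  have w_nonneg: "w z \<ge> 0" for z
    unfolding w_def using \<Phi>_nonneg p_nonneg by simp
  have prob: "prob_space (density lborel (normal_density (m j \<theta>) (sqrt (V j \<theta>))))" if "j \<in> I" for j \<theta>
    using V_pos[OF that] by (intro prob_space_normal_density) simp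
  have obs: "obs \<theta> = density Y (\<lambda>y. ennreal (p (y, \<theta>)))" for \<theta>
    unfolding obs_def Y_def p_def fst_conv snd_conv
    by (rule PiM_density) (use I prob sigma_finite_lborel in auto)
  have emeasure_obs: "emeasure (obs \<theta>) (space (obs \<theta>)) = 1" for \<theta>
    unfolding obs_def by (rule prob_space.emeasure_space_1[OF prob_space_PiM[OF prob]])
  \<comment> \<open>Tonelli: integrals against the joint density are prior averages of expectations.
    It is used for \<open>F\<close> equal to 1, \<open>|dlam|\<close>, the squared loss and the
    squared score.\<close>
  have risk_eq: "(\<integral>\<^sup>+z. ennreal (F z * w z) \<partial>?P) = (\<integral>\<^sup>+\<theta>. ennreal (\<Phi> \<theta>) * (\<integral>\<^sup>+y. ennreal (F (y, \<theta>)) \<partial>obs \<theta>) \<partial>lborel)"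
    if [measurable]: "F \<in> borel_measurable ?P" and F: "\<And>z. F z \<ge> 0" for F
  proof -
    have "(\<integral>\<^sup>+z. ennreal (F z * w z) \<partial>?P) = (\<integral>\<^sup>+\<theta>. (\<integral>\<^sup>+y. ennreal (F (y, \<theta>) * w (y, \<theta>)) \<partial>Y) \<partial>lborel)"
      by (rule P.nn_integral_snd[symmetric]) measurable
    also have "\<dots> = (\<integral>\<^sup>+\<theta>. ennreal (\<Phi> \<theta>) * (\<integral>\<^sup>+y. ennreal (F (y, \<theta>)) \<partial>obs \<theta>) \<partial>lborel)"
    proof (rule nn_integral_cong)
      fix \<theta>
      have "(\<integral>\<^sup>+y. ennreal (F (y, \<theta>) * w (y, \<theta>)) \<partial>Y)
          = (\<integral>\<^sup>+y. ennreal (\<Phi> \<theta>) * (ennreal (p (y, \<theta>)) * ennreal (F (y, \<theta>))) \<partial>Y)"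
        using F \<Phi>_nonneg p_nonneg by (simp add: w_def ennreal_mult[symmetric] mult_ac)
      also have "\<dots> = ennreal (\<Phi> \<theta>) * (\<integral>\<^sup>+y. ennreal (p (y, \<theta>)) * ennreal (F (y, \<theta>)) \<partial>Y)"
        by (rule nn_integral_cmult) measurable
      also have "(\<integral>\<^sup>+y. ennreal (p (y, \<theta>)) * ennreal (F (y, \<theta>)) \<partial>Y) = (\<integral>\<^sup>+y. ennreal (F (y, \<theta>)) \<partial>obs \<theta>)"
        unfolding obs by (rule nn_integral_density[symmetric]) measurable
      finally show "(\<integral>\<^sup>+y. ennreal (F (y, \<theta>) * w (y, \<theta>)) \<partial>Y)
          = ennreal (\<Phi> \<theta>) * (\<integral>\<^sup>+y. ennreal (F (y, \<theta>)) \<partial>obs \<theta>)" .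
    qed
    finally show ?thesis .
  qed
  have w_int: "integrable ?P w"
    using risk_eq[of "\<lambda>_. 1"] \<Phi>_int w_nonneg \<Phi>_nonneg
    by (simp add: integrable_iff_bounded emeasure_obs)
  have dlam_w: "integrable ?P (\<lambda>z. dlam (snd z) * w z)"
  proof -
    have "(\<integral>\<^sup>+z. ennreal (\<bar>dlam (snd z)\<bar> * w z) \<partial>?P) = (\<integral>\<^sup>+\<theta>. ennreal (\<Phi> \<theta>) * ennreal \<bar>dlam \<theta>\<bar> \<partial>lborel)"
      by (subst risk_eq) (auto simp: emeasure_obs)
    also have "\<dots> = (\<integral>\<^sup>+\<theta>. ennreal (norm (dlam \<theta> * \<Phi> \<theta>)) \<partial>lborel)"
      using \<Phi>_nonneg by (simp add: ennreal_mult[symmetric] abs_mult mult.commute)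
    also have "\<dots> < \<infinity>" using dlam_int by (simp add: integrable_iff_bounded)
    finally show ?thesis using w_nonneg by (simp add: integrable_iff_bounded abs_mult)
  qed
  have \<Lambda>: "(\<integral>z. dlam (snd z) * w z \<partial>?P) = (\<integral>\<theta>. dlam \<theta> * \<Phi> \<theta> \<partial>lborel)"
  proof -
    have p1: "(\<integral>y. p (y, \<theta>) \<partial>Y) = 1" for \<theta>
    proof -
      have "(\<integral>\<^sup>+y. ennreal (p (y, \<theta>)) \<partial>Y) = emeasure (obs \<theta>) (space (obs \<theta>))"
        unfolding obs by (simp add: emeasure_density cong: nn_integral_cong)
      then show ?thesis
        using p_nonneg by (subst integral_eq_nn_integral) (auto simp: emeasure_obs)
    qed
    have "(\<integral>z. dlam (snd z) * w z \<partial>?P) = (\<integral>\<theta>. (\<integral>y. dlam \<theta> * w (y, \<theta>) \<partial>Y) \<partial>lborel)"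
      using P.integral_snd[of "\<lambda>y \<theta>. dlam \<theta> * w (y, \<theta>)"] dlam_w
      by (simp add: case_prod_unfold)
    also have "\<dots> = (\<integral>\<theta>. dlam \<theta> * \<Phi> \<theta> \<partial>lborel)"
      by (simp add: w_def p1)
    finally show ?thesis .
  qed
  have R: "(\<integral>\<^sup>+z. ennreal ((est (fst z) - lam (snd z))\<^sup>2 * w z) \<partial>?P) = ?R"
    by (subst risk_eq) auto
  have D: "(\<integral>\<^sup>+z. ennreal ((q z)\<^sup>2 * w z) \<partial>?P) = ?D"
  proof -
    have "(\<integral>\<^sup>+z. ennreal ((q z)\<^sup>2 * w z) \<partial>?P) = (\<integral>\<^sup>+\<theta>. ennreal (\<Phi> \<theta>) * (\<integral>\<^sup>+y. ennreal ((q (y, \<theta>))\<^sup>2) \<partial>obs \<theta>) \<partial>lborel)"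
      by (subst risk_eq) auto
    also have "\<dots> = ?D"
    proof (rule nn_integral_cong)
      fix \<theta>
      \<comment> \<open>Variances are known to be positive only for indices in \<open>I\<close>, so
        the factors outside are replaced by a sigma-finite default.\<close>
      let ?N = "\<lambda>j. if j \<in> I then density lborel (normal_density (m j \<theta>) (sqrt (V j \<theta>))) else lborel"
      have "(\<integral>\<^sup>+y. ennreal ((q (y, \<theta>))\<^sup>2) \<partial>obs \<theta>)
          = (\<integral>\<^sup>+y. ennreal ((\<psi> \<theta> + (\<Sum>j\<in>I. u j \<theta> (y j)))\<^sup>2) \<partial>PiM I ?N)"
        unfolding obs_def q_def fst_conv snd_conv
        by (intro arg_cong2[where f = nn_integral] PiM_cong) auto
      also have "\<dots> = ennreal ((\<psi> \<theta>)\<^sup>2 + (\<Sum>j\<in>I. (a j \<theta>)\<^sup>2 / V j \<theta> + (b j \<theta>)\<^sup>2 / (V j \<theta>)\<^sup>2 / 2))"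
      proof (rule nn_integral_PiM_square_sum)
        show "sigma_finite_measure (?N j)" for j
          by (simp add: prob prob_space_imp_sigma_finite sigma_finite_lborel)
        show "u j \<theta> \<in> borel_measurable (?N j)" for j
          unfolding u_def by auto
        show "0 \<le> (a j \<theta>)\<^sup>2 / V j \<theta> + (b j \<theta>)\<^sup>2 / (V j \<theta>)\<^sup>2 / 2" if "j \<in> I" for j
          using V_pos[OF that, of \<theta>] by simp
        show "(\<integral>\<^sup>+x. ennreal ((c + u j \<theta> x)\<^sup>2) \<partial>?N j)
            = ennreal (c\<^sup>2 + ((a j \<theta>)\<^sup>2 / V j \<theta> + (b j \<theta>)\<^sup>2 / (V j \<theta>)\<^sup>2 / 2))" if "j \<in> I" for j c
          by (simp only: u_def that if_True normal_score_second_moment[OF V_pos[OF that]])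
        show "emeasure (?N j) (space (?N j)) = 1" if "j \<in> I" for j
          using prob_space.emeasure_space_1[OF prob[OF that, of \<theta>]] that by simp
      qed (rule I)
      finally show "ennreal (\<Phi> \<theta>) * (\<integral>\<^sup>+y. ennreal ((q (y, \<theta>))\<^sup>2) \<partial>obs \<theta>)
         = ennreal (\<Phi> \<theta> * ((\<psi> \<theta>)\<^sup>2 + (\<Sum>j\<in>I. (a j \<theta>)\<^sup>2 / V j \<theta> + (b j \<theta>)\<^sup>2 / (V j \<theta>)\<^sup>2 / 2)))"
        using \<Phi>_nonneg[of \<theta>] by (simp add: ennreal_mult')
    qed
    finally show ?thesis .
  qed
  have w_deriv: "((\<lambda>t. w (y, \<theta> + t *\<^sub>R v)) has_real_derivative q (y, \<theta>) * w (y, \<theta>)) (at 0)" for y \<theta>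
  proof -
    have "((\<lambda>t. p (y, \<theta> + t *\<^sub>R v)) has_real_derivative
        (\<Sum>j\<in>I. u j \<theta> (y j)) * (\<Prod>j\<in>I. normal_density (m j (\<theta> + 0 *\<^sub>R v)) (sqrt (V j (\<theta> + 0 *\<^sub>R v))) (y j))) (at 0)"
      unfolding p_def fst_conv snd_conv
    proof (rule DERIV_prod_logarithmic[OF I])
      fix j assume j: "j \<in> I"
      from normal_density_DERIV[OF m_deriv[OF j] V_deriv[OF j] V_pos[OF j], of \<theta> \<theta> "y j"]
      show "((\<lambda>t. normal_density (m j (\<theta> + t *\<^sub>R v)) (sqrt (V j (\<theta> + t *\<^sub>R v))) (y j)) has_real_derivative
          u j \<theta> (y j) * normal_density (m j (\<theta> + 0 *\<^sub>R v)) (sqrt (V j (\<theta> + 0 *\<^sub>R v))) (y j)) (at 0)"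
        by (simp add: u_def)
    qed
    from DERIV_mult[OF \<Phi>_deriv this] show ?thesis
      by (simp add: w_def q_def p_def algebra_simps)
  qed
  show ?thesis
  \<comment> \<open>Infinite risk makes the bound void, and infinite information makes the quotient
    zero.\<close>
  proof (cases "?R = \<infinity> \<or> ?D = \<infinity>")
    case True
    then show ?thesis by auto
  next
    case False
    then have le: "?\<Lambda> \<le> ?D * ?R"
      using van_trees_abstract[OF Y.sigma_finite_measure_axioms w_meas q_meas est meas(7,8) w_nonneg
          w_deriv lam_deriv w_int dlam_w]
      unfolding R D \<Lambda> by (simp add: less_top mult.commute[of ?R])
    show ?thesis
    proof (cases "?D = 0")
      case True
      \<comment> \<open>Without information \<open>le\<close> forces the numerator to vanish, and 0
        / 0 is 0 in \<open>ennreal\<close>.\<close>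
      with le show ?thesis by simp
    next
      case False
      then have "0 < ?D" by (simp only: zero_less_iff_neq_zero not_False_eq_True)
      then show ?thesis using le by (rule divide_le_posI_ennreal)
    qed
  qed
qed

subsection \<open>Measurability and differentiability along coordinates\<close>

text \<open>Lebesgue's argument: rounding one coordinate to the grid \<open>\<int> / n\<close> leaves countably many
  functions of the other coordinates, and continuity in that coordinate recovers \<open>f\<close> as \<open>n\<close> grows.\<close>

lemma borel_measurable_if_separately_continuous:
  fixes f :: "real ^ 'l \<Rightarrow> real"
  assumes cont: "\<And>k x. isCont (\<lambda>t. f (x + t *\<^sub>R axis k 1)) 0"
  shows "f \<in> borel_measurable borel"
proof -
  \<comment> \<open>Coordinates outside \<open>A\<close> are frozen at \<open>c\<close>. The
    induction frees one at a time, with \<open>c\<close> quantified inside so that the next step can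
    vary it.\<close>
  define mix where "mix A x c = (\<chi> j. if j \<in> A then x $ j else c $ j)" for A and x c :: "real ^ 'l"
  have "\<forall>c. (\<lambda>x. f (mix A x c)) \<in> borel_measurable borel" if "finite A" for A
    using that
  proof (induction A rule: finite_induct)
    case empty
    show ?case by (simp add: mix_def)
  next
    case (insert k A)
    show ?case
    proof
      fix c :: "real ^ 'l"
      define upd where "upd t = (\<chi> j. if j = k then t else c $ j)" for t
      \<comment> \<open>Rounding down to multiples of \<open>1 / (n + 1)\<close>; the successor
        keeps the mesh meaningful at \<open>n = 0\<close>.\<close>
      define r where "r n t = real_of_int \<lfloor>t * real (Suc n)\<rfloor> / real (Suc n)" for n t
      have r: "(\<lambda>n. r n t) \<longlonglongrightarrow> t" for t
      proof (rule LIMSEQ_I)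
        fix e :: real assume "e > 0"
        then obtain N where N: "inverse (real (Suc N)) < e" using reals_Archimedean by blast
        have "norm (r n t - t) < e" if "n \<ge> N" for n
        proof -
          have "real_of_int \<lfloor>t * real (Suc n)\<rfloor> \<le> t * real (Suc n)"
            "t * real (Suc n) < real_of_int \<lfloor>t * real (Suc n)\<rfloor> + 1" by linarith+
          then have "\<bar>real_of_int \<lfloor>t * real (Suc n)\<rfloor> - t * real (Suc n)\<bar> \<le> 1" by linarith
          then have "\<bar>real_of_int \<lfloor>t * real (Suc n)\<rfloor> - t * real (Suc n)\<bar> / real (Suc n) \<le> inverse (real (Suc n))"
            by (simp add: inverse_eq_divide divide_right_mono)
          moreover have "r n t - t = (real_of_int \<lfloor>t * real (Suc n)\<rfloor> - t * real (Suc n)) / real (Suc n)"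
            by (simp add: r_def diff_divide_distrib)
          ultimately have "\<bar>r n t - t\<bar> \<le> inverse (real (Suc n))" by (simp add: abs_divide)
          also have "\<dots> \<le> inverse (real (Suc N))" using that by (intro le_imp_inverse_le) auto
          finally show ?thesis using N by simp
        qed
        then show "\<exists>N. \<forall>n\<ge>N. norm (r n t - t) < e" by blast
      qed
      have IH: "(\<lambda>x. f (mix A x (upd t))) \<in> borel_measurable borel" for t
        using insert.IH by blast
      have "(\<lambda>x. f (mix A x (upd (r n (x $ k))))) \<in> borel_measurable borel" for n
      proof -
        have "(\<lambda>x. f (mix A x (upd (real_of_int \<lfloor>x $ k * real (Suc n)\<rfloor> / real (Suc n))))) \<in> borel_measurable borel"
          by (rule measurable_compose_countable[where f = "\<lambda>z x. f (mix A x (upd (real_of_int z / real (Suc n))))"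
                and g = "\<lambda>x. \<lfloor>x $ k * real (Suc n)\<rfloor>"]) (use IH in measurable)
        then show ?thesis by (simp add: r_def)
      qed
      moreover have "(\<lambda>n. f (mix A x (upd (r n (x $ k))))) \<longlonglongrightarrow> f (mix (insert k A) x c)" for x
      proof -
        \<comment> \<open>As \<open>k\<close> lies outside \<open>A\<close>, the two points differ
          in coordinate \<open>k\<close> alone, so continuity along that axis applies.\<close>
        have shift: "mix A x (upd t) = mix (insert k A) x c + (t - x $ k) *\<^sub>R axis k 1" for t
          using insert.hyps by (auto simp: mix_def upd_def vec_eq_iff axis_def)
        have "(\<lambda>n. r n (x $ k) - x $ k) \<longlonglongrightarrow> 0"
          using r[of "x $ k"] by (simp add: LIM_zero)
        from isCont_tendsto_compose[OF cont[of "mix (insert k A) x c" k] this]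
        show ?thesis by (simp add: shift)
      qed
      ultimately show "(\<lambda>x. f (mix (insert k A) x c)) \<in> borel_measurable borel"
        by (rule borel_measurable_LIMSEQ_real[rotated])
    qed
  qed
  from this[of UNIV] show ?thesis by (simp add: mix_def)
qed

text \<open>The derivative is the pointwise limit of the measurable difference quotients with steps
  \<open>1 / (n + 1)\<close>.\<close>

lemma borel_measurable_directional_derivative:
  fixes f :: "'a::euclidean_space \<Rightarrow> real"
  assumes [measurable]: "f \<in> borel_measurable borel"
    and deriv: "\<And>x. ((\<lambda>t. f (x + t *\<^sub>R v)) has_real_derivative f' x) (at 0)"
  shows "f' \<in> borel_measurable borel"
proof (rule borel_measurable_LIMSEQ_real)
  let ?h = "\<lambda>n. inverse (real (Suc n))"
  show "(\<lambda>n. (f (x + ?h n *\<^sub>R v) - f x) / ?h n) \<longlonglongrightarrow> f' x" for x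
  proof -
    have "((\<lambda>h. (f (x + h *\<^sub>R v) - f x) / h) \<longlongrightarrow> f' x) (at 0)"
      using deriv[of x] by (simp add: DERIV_def)
    moreover have "filterlim ?h (at 0) sequentially"
      by (intro filterlim_atI LIMSEQ_inverse_real_of_nat) auto
    ultimately show ?thesis by (rule filterlim_compose)
  qed
qed measurable

section \<open>Sup norm and the chain rule along a curve in C[0,1]\<close>

lemma supn01_upper:
  assumes "C01 f" "t \<in> {0..1}"
  shows "\<bar>f t\<bar> \<le> supn01 f"
proof -
  have "compact ((\<lambda>t. \<bar>f t\<bar>) ` {0..1})"
    using assms(1) unfolding C01_def by (intro compact_continuous_image continuous_intros) auto
  then have "bdd_above ((\<lambda>t. \<bar>f t\<bar>) ` {0..1})"
    by (intro bounded_imp_bdd_above compact_imp_bounded)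
  then show ?thesis using assms(2) unfolding supn01_def by (intro cSUP_upper)
qed

lemma supn01_nonneg: "C01 f \<Longrightarrow> 0 \<le> supn01 f"
  using supn01_upper[of f 0] by force

lemma supn01_least: "(\<And>t. t \<in> {0..1} \<Longrightarrow> \<bar>f t\<bar> \<le> B) \<Longrightarrow> supn01 f \<le> B"
  unfolding supn01_def by (rule cSUP_least) auto

text \<open>\<open>S\<close> is a curve in C[0,1] with derivative \<open>S'\<close> at 0 in the sup
  norm; later it is the line through a parameter in a coordinate direction.\<close>

context
  fixes S :: "real \<Rightarrow> real \<Rightarrow> real" and S' f0 :: "real \<Rightarrow> real"
  assumes S: "\<And>h. C01 (S h)" and S': "C01 S'"
    and lim: "((\<lambda>h. supn01 (\<lambda>x. (S h x - S 0 x - S' x * h) / h)) \<longlongrightarrow> 0) (at 0)"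
begin

lemma remainder_C01: "C01 (\<lambda>x. (S h x - S 0 x - S' x * h) / h)"
  using S[of h] S[of 0] S' unfolding C01_def
  \<comment> \<open>At \<open>h = 0\<close> the convention for division makes the remainder the zero
    function.\<close>
  by (cases "h = 0") (auto intro!: continuous_intros)

lemma pointwise_DERIV_if_uniform:
  assumes "t \<in> {0..1}"
  shows "((\<lambda>h. S h t) has_real_derivative S' t) (at 0)"
proof -
  have "((\<lambda>h. (S h t - S 0 t - S' t * h) / h) \<longlongrightarrow> 0) (at 0)"
    by (rule Lim_null_comparison[OF _ lim]) (use supn01_upper[OF remainder_C01 assms] in auto)
  then have "((\<lambda>h. (S h t - S 0 t - S' t * h) / h + S' t) \<longlongrightarrow> 0 + S' t) (at 0)"
    by (intro tendsto_add tendsto_const)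
  moreover have "\<forall>\<^sub>F h in at 0. (S h t - S 0 t - S' t * h) / h + S' t = (S h t - S 0 t) / h"
    by (auto simp: eventually_at_filter diff_divide_distrib)
  ultimately have "((\<lambda>h. (S h t - S 0 t) / h) \<longlongrightarrow> S' t) (at 0)"
    by (simp add: Lim_transform_eventually)
  then show ?thesis by (simp add: DERIV_def)
qed

text \<open>The increment of the curve is \<open>h (S' + r)\<close> with \<open>r\<close> tending to
  0 in the sup norm. Boundedness of the linear part disposes of \<open>r\<close>, and the Frechet
  error is o(h) because the increment is O(h).\<close>

lemma Frechet_chain_DERIV:
  assumes H2: "cond_H2 g L" and x: "x \<in> {0..1}"
  shows "((\<lambda>h. (g x (S h))\<^sup>2) has_real_derivative L x (S 0) S') (at 0)"
proof -
  let ?L = "L x (S 0)"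
  let ?r = "\<lambda>h t. (S h t - S 0 t - S' t * h) / h"
  let ?R = "\<lambda>h. supn01 (?r h)"
  have add: "\<And>h1 h2. C01 h1 \<Longrightarrow> C01 h2 \<Longrightarrow> ?L (\<lambda>t. h1 t + h2 t) = ?L h1 + ?L h2"
    and scale: "\<And>c h. C01 h \<Longrightarrow> ?L (\<lambda>t. c * h t) = c * ?L h"
    and "\<exists>C. \<forall>h. C01 h \<longrightarrow> \<bar>?L h\<bar> \<le> C * supn01 h"
    and rem: "\<And>\<epsilon>. \<epsilon> > 0 \<Longrightarrow> \<exists>\<delta>>0. \<forall>f. C01 f \<longrightarrow> supn01 (\<lambda>t. f t - S 0 t) < \<delta> \<longrightarrow>
          \<bar>(g x f)\<^sup>2 - (g x (S 0))\<^sup>2 - ?L (\<lambda>t. f t - S 0 t)\<bar> \<le> \<epsilon> * supn01 (\<lambda>t. f t - S 0 t)"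
    using H2[unfolded cond_H2_def, THEN bspec, OF x, THEN spec, THEN mp, OF S[of 0]] by simp_all
  then obtain C where C: "\<And>h. C01 h \<Longrightarrow> \<bar>?L h\<bar> \<le> C * supn01 h" by blast
  \<comment> \<open>The increment is at most \<open>|h| B\<close> once the remainder is below 1; the
    added 1 also keeps \<open>B\<close> positive for division.\<close>
  define B where "B = supn01 S' + 1"
  have B: "B > 0" using supn01_nonneg[OF S'] by (simp add: B_def)
  have R_nonneg: "?R h \<ge> 0" for h by (rule supn01_nonneg[OF remainder_C01])
  have diff_eq: "S h t - S 0 t = h * (S' t + ?r h t)" if "h \<noteq> 0" for h t
    using that by (simp add: field_simps)
  have C01_sum: "C01 (\<lambda>t. S' t + ?r h t)" for h
    using S' remainder_C01[of h] unfolding C01_def by (rule continuous_on_add)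
  have diff_le: "supn01 (\<lambda>t. S h t - S 0 t) \<le> \<bar>h\<bar> * (supn01 S' + ?R h)" if "h \<noteq> 0" for h
  proof (rule supn01_least)
    fix t :: real assume t: "t \<in> {0..1}"
    have "\<bar>S' t + ?r h t\<bar> \<le> supn01 S' + ?R h"
      using supn01_upper[OF S' t] supn01_upper[OF remainder_C01[of h] t] by linarith
    then show "\<bar>S h t - S 0 t\<bar> \<le> \<bar>h\<bar> * (supn01 S' + ?R h)"
      by (subst diff_eq[OF that]) (simp only: abs_mult mult_left_mono[OF _ abs_ge_zero])
  qed
  have L_diff: "?L (\<lambda>t. S h t - S 0 t) = h * (?L S' + ?L (?r h))" if "h \<noteq> 0" for h
  proof -
    \<comment> \<open>\<open>L\<close> acts on functions of all reals, so the identity is used at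
      every real \<open>t\<close> and not only on [0,1].\<close>
    have "?L (\<lambda>t. S h t - S 0 t) = ?L (\<lambda>t. h * (S' t + ?r h t))"
      by (rule arg_cong[where f = ?L], rule ext, rule diff_eq[OF that])
    also have "\<dots> = h * (?L S' + ?L (?r h))"
      by (simp only: scale[OF C01_sum] add[OF S' remainder_C01])
    finally show ?thesis .
  qed
  have "((\<lambda>h. ((g x (S h))\<^sup>2 - (g x (S 0))\<^sup>2) / h - ?L S') \<longlongrightarrow> 0) (at 0)"
  proof (rule tendstoI)
    fix e :: real assume e: "e > 0"
    \<comment> \<open>Chosen so that the Frechet error \<open>\<epsilon> |h| B\<close> is
      \<open>|h| e / 2\<close>; the other half of \<open>e\<close> is left for the linear part at
      the remainder.\<close>
    define \<epsilon> where "\<epsilon> = e / (2 * B)"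
    have "\<epsilon> > 0" using e B by (simp add: \<epsilon>_def)
    from rem[OF this] obtain \<delta> where \<delta>: "\<delta> > 0" and rem\<delta>: "\<And>f. C01 f \<Longrightarrow> supn01 (\<lambda>t. f t - S 0 t) < \<delta> \<Longrightarrow>
          \<bar>(g x f)\<^sup>2 - (g x (S 0))\<^sup>2 - ?L (\<lambda>t. f t - S 0 t)\<bar> \<le> \<epsilon> * supn01 (\<lambda>t. f t - S 0 t)"
      by blast
    have ev1: "\<forall>\<^sub>F h in at 0. ?R h < 1"
      by (rule order_tendstoD(2)[OF lim]) simp
    have "((\<lambda>h. C * ?R h) \<longlongrightarrow> C * 0) (at 0)"
      by (intro tendsto_mult tendsto_const lim)
    then have ev2: "\<forall>\<^sub>F h in at 0. C * ?R h < e / 2"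
      by (rule order_tendstoD(2)) (use e in simp)
    have ev3: "\<forall>\<^sub>F h in at (0::real). \<bar>h\<bar> < \<delta> / B"
      using \<delta> B by (auto simp: eventually_at intro!: exI[of _ "\<delta> / B"])
    have ev4: "\<forall>\<^sub>F h in at (0::real). h \<noteq> 0" by (simp add: eventually_at_filter)
    show "\<forall>\<^sub>F h in at 0. dist (((g x (S h))\<^sup>2 - (g x (S 0))\<^sup>2) / h - ?L S') 0 < e"
      using ev1 ev2 ev3 ev4
    proof eventually_elim
      case (elim h)
      have le: "supn01 (\<lambda>t. S h t - S 0 t) \<le> \<bar>h\<bar> * B"
        using diff_le[OF elim(4)] elim(1) by (elim order_trans) (auto intro!: mult_left_mono simp: B_def)
      also have "\<dots> < \<delta>" using elim(3) B by (simp add: field_simps)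
      finally have "\<bar>(g x (S h))\<^sup>2 - (g x (S 0))\<^sup>2 - ?L (\<lambda>t. S h t - S 0 t)\<bar>
          \<le> \<epsilon> * supn01 (\<lambda>t. S h t - S 0 t)"
        by (rule rem\<delta>[OF S])
      also have "\<dots> \<le> \<epsilon> * (\<bar>h\<bar> * B)" using le \<open>\<epsilon> > 0\<close> by (intro mult_left_mono) auto
      also have "\<dots> = \<bar>h\<bar> * (e / 2)" using B by (simp add: \<epsilon>_def)
      finally have 1: "\<bar>(g x (S h))\<^sup>2 - (g x (S 0))\<^sup>2 - h * (?L S' + ?L (?r h))\<bar> \<le> \<bar>h\<bar> * (e / 2)"
        by (simp only: L_diff[OF elim(4)])
      have "((g x (S h))\<^sup>2 - (g x (S 0))\<^sup>2) / h - ?L S' - ?L (?r h)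
          = ((g x (S h))\<^sup>2 - (g x (S 0))\<^sup>2 - h * (?L S' + ?L (?r h))) / h"
        using elim(4) by (simp add: field_simps)
      then have "\<bar>((g x (S h))\<^sup>2 - (g x (S 0))\<^sup>2) / h - ?L S' - ?L (?r h)\<bar> \<le> e / 2"
        using 1 elim(4) by (simp add: abs_divide divide_le_eq mult.commute)
      moreover have "\<bar>?L (?r h)\<bar> < e / 2"
        using C[OF remainder_C01[of h]] elim(2) by linarith
      ultimately show ?case unfolding dist_real_def diff_0_right by linarith
    qed
  qed
  then have "((\<lambda>h. ((g x (S h))\<^sup>2 - (g x (S 0))\<^sup>2) / h) \<longlongrightarrow> ?L S') (at 0)"
    by (rule LIM_zero_cancel)
  then show ?thesis by (simp add: DERIV_def)
qed

end

subsection \<open>The regression model\<close>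

text \<open>Lebesgue measure factorises over \<open>Basis\<close>, whose elements are the vectors
  \<open>axis k 1\<close>; \<open>idx\<close> inverts this labelling to return to
  coordinates.\<close>

lemma nn_integral_lborel_prod_vec:
  fixes f :: "'l::finite \<Rightarrow> real \<Rightarrow> real"
  assumes [measurable]: "\<And>k. f k \<in> borel_measurable borel" and nonneg: "\<And>k x. 0 \<le> f k x"
  shows "(\<integral>\<^sup>+\<theta>. ennreal (\<Prod>k\<in>UNIV. f k (\<theta> $ k)) \<partial>(lborel :: (real ^ 'l) measure)) = (\<Prod>k\<in>UNIV. \<integral>\<^sup>+x. ennreal (f k x) \<partial>lborel)"
proof -
  define idx where "idx b = (THE k. b = axis k (1::real))" for b :: "real ^ 'l"
  have idx[simp]: "idx (axis k 1) = k" for k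
    by (auto simp: idx_def axis_eq_axis)
  have inj: "inj (\<lambda>k::'l. axis k (1::real))" by (auto simp: inj_def axis_eq_axis)
  have Basis: "(Basis :: (real ^ 'l) set) = range (\<lambda>k. axis k 1)" by (auto simp: Basis_vec_def)
  have "(\<integral>\<^sup>+\<theta>. (\<Prod>b\<in>Basis. ennreal (f (idx b) (\<theta> \<bullet> b))) \<partial>(lborel :: (real ^ 'l) measure))
      = (\<Prod>b\<in>(Basis :: (real ^ 'l) set). \<integral>\<^sup>+x. ennreal (f (idx b) x) \<partial>lborel)"
    by (rule nn_integral_lborel_prod) auto
  then show ?thesis
    using nonneg by (simp add: Basis prod.reindex[OF inj] comp_def prod_ennreal cart_eq_inner_axis)
qed

text \<open>Risk and information take extended nonnegative values, so a divergent \<open>F_i\<close>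
  or \<open>B_i\<close> gives the bound zero. Functions on [0,1] are encoded as functions on the
  reals, and \<open>g_welldef\<close> makes \<open>g\<close> depend only on their
  restriction.\<close>

theorem theorem6p1:
  fixes n :: nat
    and S :: "real ^ 'l \<Rightarrow> real \<Rightarrow> real"
    and Sd :: "'l \<Rightarrow> real ^ 'l \<Rightarrow> real \<Rightarrow> real"
    and g :: "real \<Rightarrow> (real \<Rightarrow> real) \<Rightarrow> real"
    and L :: "real \<Rightarrow> (real \<Rightarrow> real) \<Rightarrow> (real \<Rightarrow> real) \<Rightarrow> real"
    and \<phi> :: "'l \<Rightarrow> real \<Rightarrow> real"
    and lam :: "real ^ 'l \<Rightarrow> real"
    and dlam :: "'l \<Rightarrow> real ^ 'l \<Rightarrow> real"
    and est :: "(nat \<Rightarrow> real) \<Rightarrow> real"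
    and i :: 'l
  assumes n_pos: "n \<ge> 1"
    and g_pos: "\<forall>x\<in>{0..1}. \<forall>f. L1_01 f \<longrightarrow> g x f > 0"
    and g_welldef: "\<forall>x f f'. (\<forall>t\<in>{0..1}. f t = f' t) \<longrightarrow> g x f = g x f'"
    and H1: "cond_H1 g"
    and H2: "cond_H2 g L"
    and S_cont: "\<forall>\<theta>. C01 (S \<theta>)"
    and phi_C1: "\<forall>k z. \<phi> k differentiable (at z)"
    and phi_C1': "\<forall>k. continuous_on UNIV (deriv (\<phi> k))"
    and phi_nonneg: "\<forall>k z. \<phi> k z \<ge> 0"
    and phi_bounded: "\<forall>k. bounded (range (\<phi> k))"
    and phi_density: "\<forall>k. integrable lborel (\<phi> k) \<and> (\<integral>z. \<phi> k z \<partial>lborel) = 1"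
    and fisher_fin: "\<forall>k. (\<integral>\<^sup>+ z. ennreal ((deriv (\<phi> k) z)\<^sup>2 / \<phi> k z) \<partial>lborel) < \<infinity>"
    and lam_deriv: "\<forall>\<theta>. (lam has_derivative (\<lambda>h. \<Sum>k\<in>UNIV. dlam k \<theta> * h $ k)) (at \<theta>)"
    and dlam_cont: "\<forall>k. continuous_on UNIV (dlam k)"
    and lam_tails: "\<forall>k \<theta>. ((\<lambda>t. lam (upd_coord \<theta> k t) * \<phi> k t) \<longlongrightarrow> 0) at_infinity"
    and dlam_int: "\<forall>k. (\<integral>\<^sup>+ \<theta>. ennreal (\<bar>dlam k \<theta>\<bar> * (\<Prod>m\<in>UNIV. \<phi> m (\<theta> $ m))) \<partial>lborel) < \<infinity>"
    and Sd_cont: "\<forall>k \<theta>. C01 (Sd k \<theta>)"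
    and S_diff: "\<forall>k \<theta>. ((\<lambda>h. supn01 (\<lambda>x. (S (\<theta> + h *\<^sub>R axis k 1) x - S \<theta> x - Sd k \<theta> x * h) / h))
                       \<longlongrightarrow> 0) (at 0)"
    and est_meas: "est \<in> borel_measurable (PiM {1..n} (\<lambda>_. lborel))"
    and est_sq_int: "(\<integral>\<^sup>+ \<theta>. ennreal (\<Prod>m\<in>UNIV. \<phi> m (\<theta> $ m))
                        * (\<integral>\<^sup>+ y. ennreal ((est y)\<^sup>2) \<partial>(obs_law n S g \<theta>)) \<partial>lborel) < \<infinity>"
  shows "ennreal ((\<integral>\<theta>. dlam i \<theta> * (\<Prod>m\<in>UNIV. \<phi> m (\<theta> $ m)) \<partial>lborel)\<^sup>2)
         / ( (\<Sum>j=1..n. \<integral>\<^sup>+ \<theta>. ennreal ((Sd i \<theta> (real j / real n) / g (real j / real n) (S \<theta>))\<^sup>2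
                                      * (\<Prod>m\<in>UNIV. \<phi> m (\<theta> $ m))) \<partial>lborel)
           + (\<Sum>j=1..n. \<integral>\<^sup>+ \<theta>. ennreal ((L (real j / real n) (S \<theta>) (Sd i \<theta>))\<^sup>2
                                      / (g (real j / real n) (S \<theta>)) ^ 4
                                      * (\<Prod>m\<in>UNIV. \<phi> m (\<theta> $ m))) \<partial>lborel) / 2
           + (\<integral>\<^sup>+ z. ennreal ((deriv (\<phi> i) z)\<^sup>2 / \<phi> i z) \<partial>lborel) )
       \<le> (\<integral>\<^sup>+ \<theta>. ennreal (\<Prod>m\<in>UNIV. \<phi> m (\<theta> $ m))
             * (\<integral>\<^sup>+ y. ennreal ((est y - lam \<theta>)\<^sup>2) \<partial>(obs_law n S g \<theta>)) \<partial>lborel)"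
proof -
  define x where "x j = real j / real n" for j
  define I where "I = {1..n}"
  define \<Phi> where "\<Phi> \<theta> = (\<Prod>k\<in>UNIV. \<phi> k (\<theta> $ k))" for \<theta> :: "real ^ 'l"
  define \<psi> where "\<psi> \<theta> = deriv (\<phi> i) (\<theta> $ i) / \<phi> i (\<theta> $ i)" for \<theta> :: "real ^ 'l"
  define m where "m j \<theta> = S \<theta> (x j)" for j \<theta>
  \<comment> \<open>Variances rather than standard deviations, since the Frechet expansion is given
    for the square of \<open>g\<close>.\<close>
  define V where "V j \<theta> = (g (x j) (S \<theta>))\<^sup>2" for j \<theta>
  define a where "a j \<theta> = Sd i \<theta> (x j)" for j \<theta>
  define b where "b j \<theta> = L (x j) (S \<theta>) (Sd i \<theta>)" for j \<theta>
  let ?e = "\<lambda>k :: 'l. axis k 1 :: real ^ 'l"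

  \<comment> \<open>Regularity of the means and variances\<close>
  have x: "x j \<in> {0..1}" if "j \<in> I" for j
    using that by (auto simp: x_def I_def)
  have L1: "L1_01 (S \<theta>)" for \<theta>
    using S_cont unfolding L1_01_def C01_def set_integrable_def
    by (intro borel_integrable_compact) auto
  have g_pos': "g (x j) (S \<theta>) > 0" if "j \<in> I" for j \<theta>
    using g_pos x[OF that] L1 by blast
  have sqrt_V: "sqrt (V j \<theta>) = g (x j) (S \<theta>)" if "j \<in> I" for j \<theta>
    using g_pos'[OF that, of \<theta>] by (simp add: V_def)
  have S_line: "((\<lambda>h. supn01 (\<lambda>t. (S (\<theta> + h *\<^sub>R ?e k) t - S (\<theta> + 0 *\<^sub>R ?e k) t - Sd k \<theta> t * h) / h)) \<longlongrightarrow> 0) (at 0)" for k \<theta>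
    using S_diff by simp
  \<comment> \<open>Every direction \<open>k\<close> is treated, not only \<open>i\<close>, because
    measurability rests on continuity in each coordinate.\<close>
  have m_deriv: "((\<lambda>t. m j (\<theta> + t *\<^sub>R ?e k)) has_real_derivative Sd k \<theta> (x j)) (at 0)" if "j \<in> I" for j k \<theta>
    unfolding m_def
    by (rule pointwise_DERIV_if_uniform[OF _ _ S_line x[OF that]]) (use S_cont Sd_cont in auto)
  have V_deriv: "((\<lambda>t. V j (\<theta> + t *\<^sub>R ?e k)) has_real_derivative L (x j) (S \<theta>) (Sd k \<theta>)) (at 0)" if "j \<in> I" for j k \<theta>
    using Frechet_chain_DERIV[of "\<lambda>h. S (\<theta> + h *\<^sub>R ?e k)", OF _ _ S_line H2 x[OF that]] S_cont Sd_cont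
    by (simp add: V_def)
  have m_meas: "m j \<in> borel_measurable borel" if "j \<in> I" for j
    by (rule borel_measurable_if_separately_continuous) (rule DERIV_isCont[OF m_deriv[OF that]])
  have V_meas: "V j \<in> borel_measurable borel" if "j \<in> I" for j
    by (rule borel_measurable_if_separately_continuous) (rule DERIV_isCont[OF V_deriv[OF that]])
  have a_meas: "a j \<in> borel_measurable borel" if "j \<in> I" for j
    unfolding a_def by (rule borel_measurable_directional_derivative[OF m_meas[OF that] m_deriv[OF that]])
  have b_meas: "b j \<in> borel_measurable borel" if "j \<in> I" for j
    unfolding b_def by (rule borel_measurable_directional_derivative[OF V_meas[OF that] V_deriv[OF that]])

  \<comment> \<open>Prior density and target functional\<close>
  have \<phi>_DERIV: "(\<phi> k has_real_derivative deriv (\<phi> k) z) (at z)" for k z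
    using phi_C1 by (simp add: DERIV_deriv_iff_real_differentiable)
  have \<phi>_meas[measurable]: "\<phi> k \<in> borel_measurable borel" for k
    by (intro borel_measurable_continuous_onI continuous_at_imp_continuous_on ballI DERIV_isCont[OF \<phi>_DERIV])
  have \<phi>'_meas[measurable]: "deriv (\<phi> k) \<in> borel_measurable borel" for k
    using phi_C1' by (intro borel_measurable_continuous_onI) simp
  \<comment> \<open>A zero of a nonnegative function is a minimum, so the derivative vanishes there.
    Hence \<open>\<psi> \<Phi>\<close> is the derivative of \<open>\<Phi>\<close> also where
    \<open>\<psi>\<close> divides by zero.\<close>
  have \<phi>'_0: "deriv (\<phi> k) z = 0" if "\<phi> k z = 0" for k z
    by (rule DERIV_local_min[OF \<phi>_DERIV, of 1]) (use that phi_nonneg in auto)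
  have lam_meas: "lam \<in> borel_measurable borel"
    using lam_deriv
    by (intro borel_measurable_continuous_onI continuous_at_imp_continuous_on ballI has_derivative_continuous) blast
  have dlam_meas: "dlam i \<in> borel_measurable borel"
    using dlam_cont by (intro borel_measurable_continuous_onI) simp
  have \<Phi>_meas[measurable]: "\<Phi> \<in> borel_measurable borel"
    unfolding \<Phi>_def by measurable
  have \<psi>_meas[measurable]: "\<psi> \<in> borel_measurable borel"
    unfolding \<psi>_def by measurable
  have \<Phi>_nonneg: "\<Phi> \<theta> \<ge> 0" for \<theta>
    unfolding \<Phi>_def using phi_nonneg by (intro prod_nonneg) auto
  have \<phi>_1: "(\<integral>\<^sup>+z. ennreal (\<phi> k z) \<partial>lborel) = 1" for k
    using phi_density phi_nonneg by (subst nn_integral_eq_integral) auto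
  have \<Phi>_int: "integrable lborel \<Phi>"
  proof -
    have "(\<integral>\<^sup>+\<theta>. ennreal (\<Phi> \<theta>) \<partial>lborel) = 1"
      unfolding \<Phi>_def using phi_nonneg by (subst nn_integral_lborel_prod_vec) (auto simp: \<phi>_1)
    then show ?thesis using \<Phi>_nonneg by (simp add: integrable_iff_bounded)
  qed
  have \<Phi>_deriv: "((\<lambda>t. \<Phi> (\<theta> + t *\<^sub>R ?e i)) has_real_derivative \<psi> \<theta> * \<Phi> \<theta>) (at 0)" for \<theta>
  proof -
    have "((\<lambda>t. \<Prod>k\<in>UNIV. \<phi> k ((\<theta> + t *\<^sub>R ?e i) $ k)) has_real_derivative
        (\<Sum>k\<in>UNIV. if k = i then \<psi> \<theta> else 0) * (\<Prod>k\<in>UNIV. \<phi> k ((\<theta> + 0 *\<^sub>R ?e i) $ k))) (at 0)"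
    proof (rule DERIV_prod_logarithmic)
      fix k :: 'l
      show "((\<lambda>t. \<phi> k ((\<theta> + t *\<^sub>R ?e i) $ k)) has_real_derivative
          (if k = i then \<psi> \<theta> else 0) * \<phi> k ((\<theta> + 0 *\<^sub>R ?e i) $ k)) (at 0)"
      proof (cases "k = i")
        case True
        have "((\<lambda>t. \<phi> i (t + \<theta> $ i)) has_real_derivative deriv (\<phi> i) (\<theta> $ i)) (at 0)"
          using DERIV_shift[of "\<phi> i" "deriv (\<phi> i) (\<theta> $ i)" 0 "\<theta> $ i"] \<phi>_DERIV[of i "\<theta> $ i"] by simp
        moreover have "deriv (\<phi> i) (\<theta> $ i) = \<psi> \<theta> * \<phi> i (\<theta> $ i)"
          using \<phi>'_0[of i "\<theta> $ i"] by (simp add: \<psi>_def)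
        ultimately show ?thesis using True by (simp add: axis_def add.commute)
      qed (simp add: axis_def)
    qed simp
    then show ?thesis by (simp add: \<Phi>_def)
  qed
  have lam_deriv': "((\<lambda>t. lam (\<theta> + t *\<^sub>R ?e i)) has_real_derivative dlam i \<theta>) (at 0)" for \<theta>
  proof -
    have 1: "((\<lambda>t. \<theta> + t *\<^sub>R ?e i) has_derivative (\<lambda>t. t *\<^sub>R ?e i)) (at 0)"
      by (auto intro!: derivative_eq_intros)
    have 2: "(lam has_derivative (\<lambda>h. \<Sum>k\<in>UNIV. dlam k \<theta> * h $ k)) (at (\<theta> + 0 *\<^sub>R ?e i))"
      using lam_deriv by simp
    have "(\<Sum>k\<in>UNIV. dlam k \<theta> * (t *\<^sub>R ?e i) $ k) = dlam i \<theta> * t" for t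
      by (simp add: axis_def if_distrib[of "\<lambda>u. _ * u"] cong: if_cong)
    with has_derivative_compose[OF 1 2] show ?thesis
      by (simp add: has_field_derivative_def)
  qed
  have dlam_\<Phi>: "integrable lborel (\<lambda>\<theta>. dlam i \<theta> * \<Phi> \<theta>)"
    using dlam_int[rule_format, of i] \<Phi>_nonneg dlam_meas
    by (auto simp: integrable_iff_bounded abs_mult \<Phi>_def prod_nonneg phi_nonneg)

  \<comment> \<open>Observation law and information\<close>
  have obs: "obs_law n S g \<theta> = PiM I (\<lambda>j. density lborel (normal_density (m j \<theta>) (sqrt (V j \<theta>))))" for \<theta>
    unfolding obs_law_def I_def by (rule PiM_cong) (auto simp: m_def sqrt_V I_def x_def)
  have est: "est \<in> borel_measurable (PiM I (\<lambda>_. lborel))"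
    using est_meas by (simp add: I_def)
  have V_pos: "V j \<theta> > 0" if "j \<in> I" for j \<theta>
    using g_pos'[OF that, of \<theta>] by (simp add: V_def)
  have prior: "(\<integral>\<^sup>+\<theta>. ennreal (\<Phi> \<theta> * (\<psi> \<theta>)\<^sup>2) \<partial>lborel) = (\<integral>\<^sup>+z. ennreal ((deriv (\<phi> i) z)\<^sup>2 / \<phi> i z) \<partial>lborel)"
  proof -
    \<comment> \<open>The squared score times the prior is again a product: the factor at
      \<open>i\<close> becomes the Fisher integrand, also at zeros of \<open>\<phi> i\<close> where
      both sides are 0, and the other factors integrate to 1.\<close>
    define f where "f k z = (if k = i then (deriv (\<phi> i) z)\<^sup>2 / \<phi> i z else \<phi> k z)" for k z
    have "\<Phi> \<theta> * (\<psi> \<theta>)\<^sup>2 = (\<Prod>k\<in>UNIV. f k (\<theta> $ k))" for \<theta>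
    proof -
      have "\<Phi> \<theta> = \<phi> i (\<theta> $ i) * (\<Prod>k\<in>UNIV - {i}. \<phi> k (\<theta> $ k))"
        unfolding \<Phi>_def by (rule prod.remove) auto
      moreover have "(\<Prod>k\<in>UNIV. f k (\<theta> $ k)) = f i (\<theta> $ i) * (\<Prod>k\<in>UNIV - {i}. f k (\<theta> $ k))"
        by (rule prod.remove) auto
      moreover have "(\<Prod>k\<in>UNIV - {i}. f k (\<theta> $ k)) = (\<Prod>k\<in>UNIV - {i}. \<phi> k (\<theta> $ k))"
        by (intro prod.cong) (auto simp: f_def)
      ultimately show ?thesis
        by (simp add: f_def \<psi>_def power2_eq_square)
    qed
    moreover have "f k \<in> borel_measurable borel" "f k z \<ge> 0" for k z
      using phi_nonneg by (auto simp: f_def[abs_def])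
    ultimately have "(\<integral>\<^sup>+\<theta>. ennreal (\<Phi> \<theta> * (\<psi> \<theta>)\<^sup>2) \<partial>lborel) = (\<Prod>k\<in>UNIV. \<integral>\<^sup>+z. ennreal (f k z) \<partial>lborel)"
      by (simp only: nn_integral_lborel_prod_vec)
    also have "\<dots> = (\<Prod>k\<in>UNIV. if k = i then (\<integral>\<^sup>+z. ennreal ((deriv (\<phi> i) z)\<^sup>2 / \<phi> i z) \<partial>lborel) else 1)"
      by (intro prod.cong) (auto simp: f_def \<phi>_1)
    finally show ?thesis by simp
  qed
  \<comment> \<open>Additivity of nonnegative integrals splits the total information into
    \<open>F_i\<close>, \<open>B_i\<close> and the Fisher information of the prior, infinite values
    included.\<close>
  have info: "(\<integral>\<^sup>+\<theta>. ennreal (\<Phi> \<theta> * ((\<psi> \<theta>)\<^sup>2 + (\<Sum>j\<in>I. (a j \<theta>)\<^sup>2 / V j \<theta> + (b j \<theta>)\<^sup>2 / (V j \<theta>)\<^sup>2 / 2))) \<partial>lborel)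
    = (\<Sum>j\<in>I. \<integral>\<^sup>+\<theta>. ennreal ((a j \<theta> / g (x j) (S \<theta>))\<^sup>2 * \<Phi> \<theta>) \<partial>lborel)
      + (\<Sum>j\<in>I. \<integral>\<^sup>+\<theta>. ennreal ((b j \<theta>)\<^sup>2 / (g (x j) (S \<theta>)) ^ 4 * \<Phi> \<theta>) \<partial>lborel) / 2
      + (\<integral>\<^sup>+z. ennreal ((deriv (\<phi> i) z)\<^sup>2 / \<phi> i z) \<partial>lborel)"
  proof -
    let ?A = "\<lambda>j \<theta>. (a j \<theta>)\<^sup>2 / V j \<theta> * \<Phi> \<theta>" and ?B = "\<lambda>j \<theta>. (b j \<theta>)\<^sup>2 / (V j \<theta>)\<^sup>2 * \<Phi> \<theta>"
    note [measurable] = V_meas a_meas b_meas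
    have A: "?A j \<theta> \<ge> 0" and B: "?B j \<theta> \<ge> 0" if "j \<in> I" for j \<theta>
      using V_pos[OF that, of \<theta>] \<Phi>_nonneg[of \<theta>] by simp_all
    have "ennreal (\<Phi> \<theta> * ((\<psi> \<theta>)\<^sup>2 + (\<Sum>j\<in>I. (a j \<theta>)\<^sup>2 / V j \<theta> + (b j \<theta>)\<^sup>2 / (V j \<theta>)\<^sup>2 / 2)))
      = (\<Sum>j\<in>I. ennreal (?A j \<theta>)) + (\<Sum>j\<in>I. ennreal (?B j \<theta>)) / 2 + ennreal (\<Phi> \<theta> * (\<psi> \<theta>)\<^sup>2)" for \<theta>
    proof -
      have "\<Phi> \<theta> * ((\<psi> \<theta>)\<^sup>2 + (\<Sum>j\<in>I. (a j \<theta>)\<^sup>2 / V j \<theta> + (b j \<theta>)\<^sup>2 / (V j \<theta>)\<^sup>2 / 2))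
        = (\<Sum>j\<in>I. ?A j \<theta>) + (\<Sum>j\<in>I. ?B j \<theta>) / 2 + \<Phi> \<theta> * (\<psi> \<theta>)\<^sup>2"
        by (simp add: sum.distrib sum_distrib_left sum_divide_distrib distrib_left mult.commute)
      moreover have "(\<Sum>j\<in>I. ennreal (?B j \<theta>)) / 2 = ennreal ((\<Sum>j\<in>I. ?B j \<theta>) / 2)"
        using B by (simp add: sum_ennreal sum_nonneg divide_ennreal[symmetric])
      ultimately show ?thesis
        using A B \<Phi>_nonneg[of \<theta>] by (simp add: sum_ennreal sum_nonneg ennreal_plus)
    qed
    then have "(\<integral>\<^sup>+\<theta>. ennreal (\<Phi> \<theta> * ((\<psi> \<theta>)\<^sup>2 + (\<Sum>j\<in>I. (a j \<theta>)\<^sup>2 / V j \<theta> + (b j \<theta>)\<^sup>2 / (V j \<theta>)\<^sup>2 / 2))) \<partial>lborel)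
      = (\<Sum>j\<in>I. \<integral>\<^sup>+\<theta>. ennreal (?A j \<theta>) \<partial>lborel) + (\<Sum>j\<in>I. \<integral>\<^sup>+\<theta>. ennreal (?B j \<theta>) \<partial>lborel) / 2
        + (\<integral>\<^sup>+\<theta>. ennreal (\<Phi> \<theta> * (\<psi> \<theta>)\<^sup>2) \<partial>lborel)"
      by (simp add: nn_integral_add nn_integral_sum nn_integral_divide)
    moreover have "?A j \<theta> = (a j \<theta> / g (x j) (S \<theta>))\<^sup>2 * \<Phi> \<theta>"
      "?B j \<theta> = (b j \<theta>)\<^sup>2 / (g (x j) (S \<theta>)) ^ 4 * \<Phi> \<theta>" for j \<theta>
      by (simp_all add: V_def power_divide)
    ultimately show ?thesis by (simp only: prior)
  qed
  have fin: "finite I" by (simp add: I_def)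
  have "ennreal ((\<integral>\<theta>. dlam i \<theta> * \<Phi> \<theta> \<partial>lborel)\<^sup>2)
      / (\<integral>\<^sup>+\<theta>. ennreal (\<Phi> \<theta> * ((\<psi> \<theta>)\<^sup>2 + (\<Sum>j\<in>I. (a j \<theta>)\<^sup>2 / V j \<theta> + (b j \<theta>)\<^sup>2 / (V j \<theta>)\<^sup>2 / 2))) \<partial>lborel)
    \<le> (\<integral>\<^sup>+\<theta>. ennreal (\<Phi> \<theta>) * (\<integral>\<^sup>+y. ennreal ((est y - lam \<theta>)\<^sup>2) \<partial>obs_law n S g \<theta>) \<partial>lborel)"
    unfolding obs
    by (rule van_trees_gaussian[where m = m and V = V and a = a and b = b and I = I and v = "?e i"])
      (assumption | rule fin m_meas V_meas a_meas b_meas \<Phi>_meas \<psi>_meas lam_meas dlam_meas est V_pos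
        m_deriv[of _ _ i, folded a_def] V_deriv[of _ _ i, folded b_def] \<Phi>_nonneg \<Phi>_deriv \<Phi>_int lam_deriv' dlam_\<Phi>)+
  then show ?thesis
    unfolding info unfolding a_def b_def \<Phi>_def x_def I_def .
qed

end
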